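(* Real Value Perception Manipulation (RVPM) can be solved in polynomial time under the $l_\infty$ norm when the number of issues $d$ is a constant, for destructive control and arbitrary scoring rules.
   Context: Spatial election model: $n$ candidates $c_1,\dots,c_n$ and $m$ voters $v_1,\dots,v_m$ are points of $\mathbb R^d$. Each voter ranks candidates by increasing $l_\infty$ distance; closest ranked 1; original rankings have no ties. A scoring rule is a non-increasing $f:\{1,\dots,n\}\to\mathbb R$: a candidate ranked $t$ by a voter receives $f(t)$; totals summed; highest total wins. Given $\epsilon>0$, an adversary may replace target $c_1$ by any $\tilde c_1\in\mathbb R^d$ with $\|\tilde c_1-c_1\|_\infty\le\epsilon$; ties created by the manipulation are broken in the adversary's favor. Destructive control: decide whether some such $\tilde c_1$ makes $c_1$ lose (with $c_1$ placed behind equidistant candidates, some other candidate's total is at least $c_1$'s total). *)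

theory Defs
  imports Complex_Main
begin

text \<open>Points of R^d are functions nat => real; only coordinates 0..<d matter.
  Candidates are indexed 0..<n (index 0 is the target c_1), voters 0..<m.\<close>

definition linf_dist :: "nat \<Rightarrow> (nat \<Rightarrow> real) \<Rightarrow> (nat \<Rightarrow> real) \<Rightarrow> real" where
  "linf_dist d x y = Max ((\<lambda>k. \<bar>x k - y k\<bar>) ` {0..<d})"

definition prefers :: "nat \<Rightarrow> (nat \<Rightarrow> nat \<Rightarrow> real) \<Rightarrow> (nat \<Rightarrow> nat \<Rightarrow> real)
                      \<Rightarrow> nat \<Rightarrow> nat \<Rightarrow> nat \<Rightarrow> bool" where
  "prefers d p v i j' j \<longleftrightarrow>
     linf_dist d (v i) (p j') < linf_dist d (v i) (p j) \<or>
     (linf_dist d (v i) (p j') = linf_dist d (v i) (p j) \<and> j = 0 \<and> j' \<noteq> 0)"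

definition rank :: "nat \<Rightarrow> nat \<Rightarrow> (nat \<Rightarrow> nat \<Rightarrow> real) \<Rightarrow> (nat \<Rightarrow> nat \<Rightarrow> real)
                      \<Rightarrow> nat \<Rightarrow> nat \<Rightarrow> nat" where
  "rank d n p v i j = 1 + card {j' \<in> {0..<n}. j' \<noteq> j \<and> prefers d p v i j' j}"

definition score :: "nat \<Rightarrow> nat \<Rightarrow> nat \<Rightarrow> (nat \<Rightarrow> real) \<Rightarrow> (nat \<Rightarrow> nat \<Rightarrow> real)
                      \<Rightarrow> (nat \<Rightarrow> nat \<Rightarrow> real) \<Rightarrow> nat \<Rightarrow> real" where
  "score d n m f p v j = (\<Sum>i<m. f (rank d n p v i j))"

definition destructive_control :: "nat \<Rightarrow> nat \<Rightarrow> nat \<Rightarrow> (nat \<Rightarrow> real)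
      \<Rightarrow> (nat \<Rightarrow> nat \<Rightarrow> real) \<Rightarrow> (nat \<Rightarrow> nat \<Rightarrow> real) \<Rightarrow> real \<Rightarrow> bool" where
  "destructive_control d n m f c v eps \<longleftrightarrow>
     (\<exists>c1'. linf_dist d c1' (c 0) \<le> eps \<and>
        (\<exists>j\<in>{1..<n}. score d n m f (c(0 := c1')) v j \<ge> score d n m f (c(0 := c1')) v 0))"

definition valid_instance :: "nat \<Rightarrow> nat \<Rightarrow> nat \<Rightarrow> (nat \<Rightarrow> real)
      \<Rightarrow> (nat \<Rightarrow> nat \<Rightarrow> real) \<Rightarrow> (nat \<Rightarrow> nat \<Rightarrow> real) \<Rightarrow> real \<Rightarrow> bool" where
  "valid_instance d n m f c v eps \<longleftrightarrow>
     d \<ge> 1 \<and> n \<ge> 1 \<and> eps > 0 \<and>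
     (\<forall>s t. 1 \<le> s \<longrightarrow> s \<le> t \<longrightarrow> t \<le> n \<longrightarrow> f t \<le> f s) \<and>
     (\<forall>i<m. \<forall>j<n. \<forall>j'<n. j \<noteq> j' \<longrightarrow> linf_dist d (v i) (c j) \<noteq> linf_dist d (v i) (c j'))"

text \<open>Integer registers (used for counters and indirect addressing; only addition
  and subtraction) and real registers (exact field operations and comparisons;
  no floor / real-to-integer conversion). Constants are integers. Every executed
  instruction costs one time unit.\<close>

datatype instr =
    IConst nat int
  | IAdd nat nat nat
  | ISub nat nat nat
  | ILoad nat nat
  | IStore nat nat
  | RConst nat int
  | RAdd nat nat nat
  | RSub nat nat nat
  | RMul nat nat nat
  | RDiv nat nat nat
  | RLoad nat nat
  | RStore nat nat
  | JmpILe nat nat nat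
  | JmpRLe nat nat nat
  | Jmp nat
  | Halt

type_synonym config = "nat \<times> (nat \<Rightarrow> int) \<times> (nat \<Rightarrow> real)"

definition halted :: "instr list \<Rightarrow> config \<Rightarrow> bool" where
  "halted P cf \<longleftrightarrow> fst cf \<ge> length P \<or> P ! fst cf = Halt"

fun exec :: "instr \<Rightarrow> config \<Rightarrow> config" where
  "exec (IConst a k) (pc, im, rm) = (Suc pc, im(a := k), rm)"
| "exec (IAdd a b e) (pc, im, rm) = (Suc pc, im(a := im b + im e), rm)"
| "exec (ISub a b e) (pc, im, rm) = (Suc pc, im(a := im b - im e), rm)"
| "exec (ILoad a b) (pc, im, rm) = (Suc pc, im(a := im (nat (im b))), rm)"
| "exec (IStore a b) (pc, im, rm) = (Suc pc, im(nat (im b) := im a), rm)"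
| "exec (RConst a k) (pc, im, rm) = (Suc pc, im, rm(a := of_int k))"
| "exec (RAdd a b e) (pc, im, rm) = (Suc pc, im, rm(a := rm b + rm e))"
| "exec (RSub a b e) (pc, im, rm) = (Suc pc, im, rm(a := rm b - rm e))"
| "exec (RMul a b e) (pc, im, rm) = (Suc pc, im, rm(a := rm b * rm e))"
| "exec (RDiv a b e) (pc, im, rm) = (Suc pc, im, rm(a := rm b / rm e))"
| "exec (RLoad a b) (pc, im, rm) = (Suc pc, im, rm(a := rm (nat (im b))))"
| "exec (RStore a b) (pc, im, rm) = (Suc pc, im, rm(nat (im b) := rm a))"
| "exec (JmpILe a b l) (pc, im, rm) = ((if im a \<le> im b then l else Suc pc), im, rm)"
| "exec (JmpRLe a b l) (pc, im, rm) = ((if rm a \<le> rm b then l else Suc pc), im, rm)"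
| "exec (Jmp l) (pc, im, rm) = (l, im, rm)"
| "exec Halt cf = cf"

definition step :: "instr list \<Rightarrow> config \<Rightarrow> config" where
  "step P cf = (if halted P cf then cf else exec (P ! fst cf) cf)"

definition run :: "instr list \<Rightarrow> nat \<Rightarrow> config \<Rightarrow> config" where
  "run P t cf = (step P ^^ t) cf"

text \<open>Input encoding of an RVPM instance. Integer registers: 0 = d, 1 = n, 2 = m.
  Real registers: 0 = eps; t = f t for 1 <= t <= n;
  n+1 + j*d + k = coordinate k of candidate j (j<n, k<d);
  n+1 + n*d + i*d + k = coordinate k of voter i (i<m, k<d); all others 0.\<close>
definition input_config :: "nat \<Rightarrow> nat \<Rightarrow> nat \<Rightarrow> (nat \<Rightarrow> real)
      \<Rightarrow> (nat \<Rightarrow> nat \<Rightarrow> real) \<Rightarrow> (nat \<Rightarrow> nat \<Rightarrow> real) \<Rightarrow> real \<Rightarrow> config" where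
  "input_config d n m f c v eps =
     (0,
      (\<lambda>a. if a = 0 then int d else if a = 1 then int n else if a = 2 then int m else 0),
      (\<lambda>a. if a = 0 then eps
           else if a \<le> n then f a
           else if a < n + 1 + n * d then c ((a - (n + 1)) div d) ((a - (n + 1)) mod d)
           else if a < n + 1 + n * d + m * d
             then v ((a - (n + 1 + n * d)) div d) ((a - (n + 1 + n * d)) mod d)
           else 0))"

definition accepts :: "config \<Rightarrow> bool" where
  "accepts cf \<longleftrightarrow> fst (snd cf) 0 = 1"

end

theory Submission
  imports Defs
begin

text \<open>Let \<open>r i j\<close> be the distance from voter \<open>i\<close> to candidate \<open>j\<close>. The target is behind
  candidate \<open>j\<close> for voter \<open>i\<close> iff some coordinate \<open>k\<close> of its new position is at most
  \<open>v i k - r i j\<close> or at least \<open>v i k + r i j\<close>. Rounding every coordinate down to the nearest value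
  among these thresholds and the lower end \<open>c 0 k - eps\<close> of the permitted range keeps all such
  conditions true and, as the scoring rule is non-increasing, can neither raise the score of the
  target nor lower that of a rival. Hence it suffices to try the points all of whose coordinates
  are critical values, which are polynomially many for fixed \<open>d\<close>.

  The search is written as a term of a small language of bounded sums and comparisons;
  every term of that language compiles to machine code whose running time is polynomial.\<close>

subsection \<open>Expressions with bounded sums\<close>

text \<open>Since ties put the target behind its rivals, the conditions to be preserved,
  \<open>r i j \<le> linf_dist d (v i) x\<close>, are closed, so rounding may land exactly on a
  threshold. The number \<open>d\<close> is fixed, hence the search can be a term that depends on
  \<open>d\<close> alone: \<open>3 * d\<close> nested sums, three selector variables per coordinate,
  each with a range linear in \<open>n + m\<close>. Real data influence the integers of the language
  only through 0/1 comparisons; this is why one exponent bounds the running time of a term uniformly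
  in the real input, and no separate count of critical points is required. A bounded sum of naturals
  serves as an existential quantifier (it is nonzero iff some term is), as a counter in the
  definition of a rank, and, as a real sum of ones, as the conversion from integers to reals, for
  which the machine has no instruction.\<close>

datatype iexp =
    ICst nat
  | IVar nat
  | IPlus iexp iexp
  | ISum nat iexp iexp
  | ILe rexp rexp
and rexp =
    RIn iexp
  | RCst int
  | RPlus rexp rexp
  | RMinus rexp rexp
  | RTimes rexp rexp
  | RSum nat iexp rexp

primrec ival :: "(nat \<Rightarrow> real) \<Rightarrow> (nat \<Rightarrow> nat) \<Rightarrow> iexp \<Rightarrow> nat"
  and rval :: "(nat \<Rightarrow> real) \<Rightarrow> (nat \<Rightarrow> nat) \<Rightarrow> rexp \<Rightarrow> real" where
  "ival \<rho> env (ICst k) = k"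
| "ival \<rho> env (IVar x) = env x"
| "ival \<rho> env (IPlus a b) = ival \<rho> env a + ival \<rho> env b"
| "ival \<rho> env (ISum x a b) = (\<Sum>i<ival \<rho> env a. ival \<rho> (env(x := i)) b)"
| "ival \<rho> env (ILe a b) = of_bool (rval \<rho> env a \<le> rval \<rho> env b)"
| "rval \<rho> env (RIn a) = \<rho> (ival \<rho> env a)"
| "rval \<rho> env (RCst k) = of_int k"
| "rval \<rho> env (RPlus a b) = rval \<rho> env a + rval \<rho> env b"
| "rval \<rho> env (RMinus a b) = rval \<rho> env a - rval \<rho> env b"
| "rval \<rho> env (RTimes a b) = rval \<rho> env a * rval \<rho> env b"
| "rval \<rho> env (RSum x a b) = (\<Sum>i<ival \<rho> env a. rval \<rho> (env(x := i)) b)"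

text \<open>The constants count instructions of the compiled code; for a sum these are the setup,
  one test and three closing instructions per round, and the last test together with the clean-up. A
  comparison takes 3 steps only if it fails. The bracketing to the right matches repeated use of
  \<open>reach_trans\<close>.\<close>

primrec itime :: "(nat \<Rightarrow> real) \<Rightarrow> (nat \<Rightarrow> nat) \<Rightarrow> iexp \<Rightarrow> nat"
  and rtime :: "(nat \<Rightarrow> real) \<Rightarrow> (nat \<Rightarrow> nat) \<Rightarrow> rexp \<Rightarrow> nat" where
  "itime \<rho> env (ICst k) = 1"
| "itime \<rho> env (IVar x) = 2"
| "itime \<rho> env (IPlus a b) = itime \<rho> env a + (itime \<rho> env b + 1)"
| "itime \<rho> env (ISum x a b) =
     itime \<rho> env a + (4 + ((\<Sum>i<ival \<rho> env a. 1 + (itime \<rho> (env(x := i)) b + 3)) + 4))"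
| "itime \<rho> env (ILe a b) = rtime \<rho> env a + (rtime \<rho> env b + 3)"
| "rtime \<rho> env (RIn a) = itime \<rho> env a + 2"
| "rtime \<rho> env (RCst k) = 1"
| "rtime \<rho> env (RPlus a b) = rtime \<rho> env a + (rtime \<rho> env b + 1)"
| "rtime \<rho> env (RMinus a b) = rtime \<rho> env a + (rtime \<rho> env b + 1)"
| "rtime \<rho> env (RTimes a b) = rtime \<rho> env a + (rtime \<rho> env b + 1)"
| "rtime \<rho> env (RSum x a b) =
     itime \<rho> env a + (5 + ((\<Sum>i<ival \<rho> env a. 1 + (rtime \<rho> (env(x := i)) b + 3)) + 2))"

text \<open>Bounds both the indices of the variables of an expression and the number of
  registers its code needs.\<close>
primrec iwidth :: "iexp \<Rightarrow> nat" and rwidth :: "rexp \<Rightarrow> nat" where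
  "iwidth (ICst k) = 1"
| "iwidth (IVar x) = Suc x"
| "iwidth (IPlus a b) = Suc (iwidth a + iwidth b)"
| "iwidth (ISum x a b) = 4 + x + iwidth a + iwidth b"
| "iwidth (ILe a b) = Suc (rwidth a + rwidth b)"
| "rwidth (RIn a) = Suc (iwidth a)"
| "rwidth (RCst k) = 1"
| "rwidth (RPlus a b) = Suc (rwidth a + rwidth b)"
| "rwidth (RMinus a b) = Suc (rwidth a + rwidth b)"
| "rwidth (RTimes a b) = Suc (rwidth a + rwidth b)"
| "rwidth (RSum x a b) = 4 + x + iwidth a + rwidth b"

text \<open>The code is placed at address \<open>p\<close>, leaves its result in register \<open>s\<close> and uses only
  registers from \<open>s\<close> on. Variable \<open>x\<close> lives in integer register \<open>Suc x\<close>, and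
  integer register 0 holds the address at which the copy of the real input starts.\<close>
primrec icode :: "nat \<Rightarrow> nat \<Rightarrow> iexp \<Rightarrow> instr list"
  and rcode :: "nat \<Rightarrow> nat \<Rightarrow> rexp \<Rightarrow> instr list" where
  "icode p s (ICst k) = [IConst s (int k)]"
| "icode p s (IVar x) = [IConst s 0, IAdd s s (Suc x)]"
| "icode p s (IPlus a b) = icode p s a @ icode (p + length (icode p s a)) (Suc s) b
     @ [IAdd s s (Suc s)]"
| "icode p s (ISum x a b) =
     (let q = p + length (icode p s a); body = icode (q + 5) (s + 4) b in
      icode p s a @
      [IConst (s + 2) 0, IAdd (s + 1) (s + 2) (Suc x), IConst (Suc x) 0, IConst (s + 3) 1,
       JmpILe s (Suc x) (q + 8 + length body)] @ body @
      [IAdd (s + 2) (s + 2) (s + 4), IAdd (Suc x) (Suc x) (s + 3), Jmp (q + 4),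
       IConst (s + 3) 0, IAdd s (s + 2) (s + 3), IAdd (Suc x) (s + 1) (s + 3)])"
| "icode p s (ILe a b) =
     (let A = rcode p s a; B = rcode (p + length A) (Suc s) b in
      A @ B @ [IConst s 1, JmpRLe s (Suc s) (p + length A + length B + 3), IConst s 0])"
| "rcode p s (RIn a) = icode p s a @ [IAdd s s 0, RLoad s s]"
| "rcode p s (RCst k) = [RConst s k]"
| "rcode p s (RPlus a b) = rcode p s a @ rcode (p + length (rcode p s a)) (Suc s) b
     @ [RAdd s s (Suc s)]"
| "rcode p s (RMinus a b) = rcode p s a @ rcode (p + length (rcode p s a)) (Suc s) b
     @ [RSub s s (Suc s)]"
| "rcode p s (RTimes a b) = rcode p s a @ rcode (p + length (rcode p s a)) (Suc s) b
     @ [RMul s s (Suc s)]"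
| "rcode p s (RSum x a b) =
     (let q = p + length (icode p s a); body = rcode (q + 6) (s + 4) b in
      icode p s a @
      [IConst (s + 2) 0, IAdd (s + 1) (s + 2) (Suc x), IConst (Suc x) 0, IConst (s + 3) 1,
       RConst s 0, JmpILe s (Suc x) (q + 9 + length body)] @ body @
      [RAdd s s (s + 4), IAdd (Suc x) (Suc x) (s + 3), Jmp (q + 5),
       IAdd (Suc x) (s + 1) (s + 2)])"

subsection \<open>Machine code\<close>

text \<open>A total-correctness triple with a time budget. As \<open>T\<close> is only an upper
  bound, branches of different length can share one budget.\<close>

definition reach :: "instr list \<Rightarrow> nat \<Rightarrow> config \<Rightarrow> (config \<Rightarrow> bool) \<Rightarrow> bool" where
  "reach P T cf Q \<longleftrightarrow> (\<exists>t\<le>T. Q (run P t cf))"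

lemma run_add: "run P (t + u) cf = run P u (run P t cf)"
  by (simp add: run_def add.commute[of t u] funpow_add)

lemma reach_refl: "Q cf \<Longrightarrow> reach P T cf Q"
  unfolding reach_def by (rule exI[of _ 0]) (simp add: run_def)

lemma reach_trans:
  assumes "reach P T cf Q" "\<And>cf'. Q cf' \<Longrightarrow> reach P U cf' R"
  shows "reach P (T + U) cf R"
proof -
  obtain t where t: "t \<le> T" "Q (run P t cf)" using assms(1) by (auto simp: reach_def)
  obtain u where "u \<le> U" "R (run P u (run P t cf))"
    using assms(2)[OF t(2)] unfolding reach_def by blast
  with t show ?thesis unfolding reach_def by (metis add_mono run_add)
qed

lemma reach_mono:
  "reach P T cf Q \<Longrightarrow> T \<le> U \<Longrightarrow> (\<And>cf'. Q cf' \<Longrightarrow> R cf') \<Longrightarrow> reach P U cf R"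
  unfolding reach_def by (meson order_trans)

lemma reach_step:
  assumes "p < length P" "P ! p = i" "reach P T (exec i (p, im, rm)) Q"
  shows "reach P (Suc T) (p, im, rm) Q"
proof -
  have "reach P 1 (p, im, rm) (\<lambda>cf. cf = exec i (p, im, rm))"
    unfolding reach_def using assms(1,2)
    by (intro exI[of _ 1]) (auto simp: run_def step_def halted_def)
  from reach_trans[OF this, of T Q] assms(3) show ?thesis by simp
qed

text \<open>The invariant is indexed by the number of completed rounds, and the budget may differ
  from round to round because the cost of a loop body depends on the loop variable.\<close>

lemma reach_loop:
  assumes "I 0 cf" "\<And>k cf. k < N \<Longrightarrow> I k cf \<Longrightarrow> reach P (T k) cf (I (Suc k))"
  shows "reach P (\<Sum>k<N. T k) cf (I N)"
  using assms
proof (induction N)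
  case 0
  then show ?case by (simp add: reach_refl)
next
  case (Suc N)
  have "reach P (\<Sum>k<N. T k) cf (I N)" using Suc by simp
  from reach_trans[OF this Suc.prems(2)] show ?case by simp
qed

definition code_at :: "instr list \<Rightarrow> nat \<Rightarrow> instr list \<Rightarrow> bool" where
  "code_at P p c \<longleftrightarrow> (\<forall>i<length c. p + i < length P \<and> P ! (p + i) = c ! i)"

lemma code_at_Nil [simp]: "code_at P p []"
  by (simp add: code_at_def)

lemma code_at_append [simp]:
  "code_at P p (a @ b) \<longleftrightarrow> code_at P p a \<and> code_at P (p + length a) b"
proof
  assume *: "code_at P p (a @ b)"
  have "code_at P p a"
    unfolding code_at_def
  proof (intro allI impI)
    fix i assume "i < length a"
    with * show "p + i < length P \<and> P ! (p + i) = a ! i"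
      unfolding code_at_def by (auto simp: nth_append dest: spec[of _ i])
  qed
  moreover have "code_at P (p + length a) b"
    unfolding code_at_def
  proof (intro allI impI)
    fix i assume "i < length b"
    with * show "p + length a + i < length P \<and> P ! (p + length a + i) = b ! i"
      unfolding code_at_def
      by (auto simp: nth_append add.assoc dest: spec[of _ "length a + i"])
  qed
  ultimately show "code_at P p a \<and> code_at P (p + length a) b" ..
next
  assume *: "code_at P p a \<and> code_at P (p + length a) b"
  show "code_at P p (a @ b)"
    unfolding code_at_def
  proof (intro allI impI)
    fix i assume i: "i < length (a @ b)"
    show "p + i < length P \<and> P ! (p + i) = (a @ b) ! i"
    proof (cases "i < length a")
      case True
      with * show ?thesis by (auto simp: code_at_def nth_append)
    next
      case False
      with i have "i - length a < length b" by simp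
      with * False show ?thesis
        unfolding code_at_def
        by (auto simp: nth_append dest!: spec[of _ "i - length a"])
    qed
  qed
qed

lemma code_at_Cons [simp]:
  "code_at P p (i # c) \<longleftrightarrow> p < length P \<and> P ! p = i \<and> code_at P (Suc p) c"
  using code_at_append[of P p "[i]" c] by (simp add: code_at_def)

text \<open>Blocks of such instructions can be executed symbolically by \<open>fold exec\<close>,
  without following the program counter through the whole program.\<close>

definition straight :: "instr \<Rightarrow> bool" where
  "straight i \<longleftrightarrow> (\<forall>cf. fst (exec i cf) = Suc (fst cf))"

lemma straight_simps [simp]:
  "straight (IConst a k)" "straight (IAdd a b e)" "straight (RConst a k)"
  "straight (RAdd a b e)" "straight (RSub a b e)" "straight (RMul a b e)"
  "straight (RLoad a b)" "straight (RStore a b)"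
  by (auto simp: straight_def)

lemma reach_straight:
  assumes "code_at P p c" "\<forall>i\<in>set c. straight i" "Q (fold exec c (p, im, rm))"
  shows "reach P (length c) (p, im, rm) Q"
  using assms
proof (induction c arbitrary: p im rm)
  case Nil
  then show ?case by (simp add: reach_refl)
next
  case (Cons i c)
  obtain im' rm' where e: "exec i (p, im, rm) = (Suc p, im', rm')"
    using Cons.prems(2) unfolding straight_def
    by (metis fst_conv list.set_intros(1) prod.collapse)
  show ?case
    unfolding list.size add_Suc_right add_0_right
    by (rule reach_step, use Cons.prems(1) in simp, use Cons.prems(1) in simp, unfold e)
      (rule Cons.IH, use Cons.prems e in auto)
qed

section \<open>Correctness of the compiled code\<close>

definition env_ok :: "nat \<Rightarrow> nat \<Rightarrow> (nat \<Rightarrow> real) \<Rightarrow> (nat \<Rightarrow> nat) \<Rightarrow> (nat \<Rightarrow> int)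
    \<Rightarrow> (nat \<Rightarrow> real) \<Rightarrow> bool" where
  "env_ok V B \<rho> env im rm \<longleftrightarrow>
     im 0 = int B \<and> (\<forall>a. rm (B + a) = \<rho> a) \<and> (\<forall>y<V. im (Suc y) = int (env y))"

text \<open>Real scratch space is confined to \<open>[s, B)\<close>, between the pending
  intermediate results and the copied input. The variables sit in integer registers
  \<open>1..V\<close>, so they are protected as soon as \<open>V < s\<close>.\<close>

definition frame :: "nat \<Rightarrow> nat \<Rightarrow> (nat \<Rightarrow> int) \<Rightarrow> (nat \<Rightarrow> real) \<Rightarrow> (nat \<Rightarrow> int)
    \<Rightarrow> (nat \<Rightarrow> real) \<Rightarrow> bool" where
  "frame B s im rm im' rm' \<longleftrightarrow>
     (\<forall>y<s. im' y = im y) \<and> (\<forall>y. y < s \<or> B \<le> y \<longrightarrow> rm' y = rm y)"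

lemma env_ok_frame:
  "env_ok V B \<rho> env im rm \<Longrightarrow> frame B s im rm im' rm' \<Longrightarrow> V < s
    \<Longrightarrow> env_ok V B \<rho> env im' rm'"
  by (auto simp: env_ok_def frame_def)

definition ipost where
  "ipost B q s im rm r = (\<lambda>(pc, im', rm'). pc = q \<and> im' s = int r \<and> frame B s im rm im' rm')"

definition rpost where
  "rpost B q s im rm r = (\<lambda>(pc, im', rm'). pc = q \<and> rm' s = r \<and> frame B s im rm im' rm')"

text \<open>The common pattern of the three real operations: the first operand waits in register
  \<open>s\<close>, which the frame protects while the second is computed from \<open>Suc s\<close>
  on.\<close>

lemma reach_binary:
  assumes "reach P Ta (p, im, rm) (rpost B q s im rm x)"
    and "\<And>im1 rm1. frame B s im rm im1 rm1
      \<Longrightarrow> reach P Tb (q, im1, rm1) (rpost B q' (Suc s) im1 rm1 y)"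
    and "code_at P q' [i]" "s < B"
    and "\<And>im rm. exec i (q', im, rm) = (Suc q', im, rm(s := g (rm s) (rm (Suc s))))"
  shows "reach P (Ta + (Tb + 1)) (p, im, rm) (rpost B (Suc q') s im rm (g x y))"
proof (rule reach_trans[OF assms(1)])
  fix cf assume A: "rpost B q s im rm x cf"
  obtain im1 rm1 where cf: "cf = (q, im1, rm1)" using A by (auto simp: rpost_def)
  show "reach P (Tb + 1) cf (rpost B (Suc q') s im rm (g x y))"
    unfolding cf
  proof (rule reach_trans)
    show "reach P Tb (q, im1, rm1) (rpost B q' (Suc s) im1 rm1 y)"
      by (rule assms(2)) (use A cf in \<open>auto simp: rpost_def\<close>)
    fix cf2 assume B: "rpost B q' (Suc s) im1 rm1 y cf2"
    obtain im2 rm2 where cf2: "cf2 = (q', im2, rm2)" using B by (auto simp: rpost_def)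
    have "reach P (Suc 0) cf2 (rpost B (Suc q') s im rm (g x y))"
      unfolding cf2
      by (rule reach_step[of _ _ i])
        (use A B cf cf2 assms(3-5) in \<open>auto intro!: reach_refl simp: rpost_def frame_def\<close>)
    then show "reach P 1 cf2 (rpost B (Suc q') s im rm (g x y))" by simp
  qed
qed

text \<open>\<open>V\<close> and \<open>B\<close> stay fixed in the induction while \<open>s\<close>
  grows with the nesting. The bound on the width by \<open>V\<close> puts all variables below the
  registers in use; the bound on \<open>s + iwidth e\<close> keeps scratch reals off the input
  copy.\<close>

lemma code_correct:
  fixes e :: iexp and r :: rexp
  shows "\<lbrakk>code_at P p (icode p s e); iwidth e \<le> V; V < s; s + iwidth e \<le> B;
      env_ok V B \<rho> env im rm\<rbrakk>
    \<Longrightarrow> reach P (itime \<rho> env e) (p, im, rm)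
          (ipost B (p + length (icode p s e)) s im rm (ival \<rho> env e))"
  and "\<lbrakk>code_at P p (rcode p s r); rwidth r \<le> V; V < s; s + rwidth r \<le> B;
      env_ok V B \<rho> env im rm\<rbrakk>
    \<Longrightarrow> reach P (rtime \<rho> env r) (p, im, rm)
          (rpost B (p + length (rcode p s r)) s im rm (rval \<rho> env r))"
proof (induction e and r arbitrary: p s env im rm and p s env im rm)
  case (ICst k)
  have "reach P (length [IConst s (int k)]) (p, im, rm)
      (ipost B (p + length (icode p s (ICst k))) s im rm (ival \<rho> env (ICst k)))"
    by (rule reach_straight) (use ICst in \<open>auto simp: ipost_def frame_def\<close>)
  then show ?case by simp
next
  case (IVar x)
  have "reach P (length [IConst s 0, IAdd s s (Suc x)]) (p, im, rm)
      (ipost B (p + length (icode p s (IVar x))) s im rm (ival \<rho> env (IVar x)))"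
    by (rule reach_straight) (use IVar in \<open>auto simp: ipost_def frame_def env_ok_def\<close>)
  then show ?case by (simp add: numeral_2_eq_2)
next
  case (IPlus a b)
  let ?q = "p + length (icode p s a)"
  show ?case
    unfolding itime.simps
  proof (rule reach_trans)
    show "reach P (itime \<rho> env a) (p, im, rm) (ipost B ?q s im rm (ival \<rho> env a))"
      by (rule IPlus.IH) (use IPlus.prems in auto)
    fix cf assume A: "ipost B ?q s im rm (ival \<rho> env a) cf"
    obtain im1 rm1 where cf: "cf = (?q, im1, rm1)" using A by (auto simp: ipost_def)
    let ?q' = "?q + length (icode ?q (Suc s) b)"
    show "reach P (itime \<rho> env b + 1) cf (ipost B (p + length (icode p s (IPlus a b))) s im rm
        (ival \<rho> env (IPlus a b)))"
    proof (rule reach_trans)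
      show "reach P (itime \<rho> env b) cf (ipost B ?q' (Suc s) im1 rm1 (ival \<rho> env b))"
        unfolding cf
        by (rule IPlus.IH)
          (use IPlus.prems A cf in \<open>auto simp: ipost_def elim: env_ok_frame\<close>)
      fix cf2 assume B: "ipost B ?q' (Suc s) im1 rm1 (ival \<rho> env b) cf2"
      obtain im2 rm2 where cf2: "cf2 = (?q', im2, rm2)" using B by (auto simp: ipost_def)
      show "reach P 1 cf2 (ipost B (p + length (icode p s (IPlus a b))) s im rm
          (ival \<rho> env (IPlus a b)))"
        unfolding cf2 One_nat_def
        by (rule reach_step)
          (use A B cf cf2 IPlus.prems in
            \<open>auto intro!: reach_refl simp: ipost_def frame_def add.assoc\<close>)
    qed
  qed
next
  case (ILe a b)
  let ?q = "p + length (rcode p s a)"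
  show ?case
    unfolding itime.simps
  proof (rule reach_trans)
    show "reach P (rtime \<rho> env a) (p, im, rm) (rpost B ?q s im rm (rval \<rho> env a))"
      by (rule ILe.IH) (use ILe.prems in \<open>auto simp: Let_def\<close>)
    fix cf assume A: "rpost B ?q s im rm (rval \<rho> env a) cf"
    obtain im1 rm1 where cf: "cf = (?q, im1, rm1)" using A by (auto simp: rpost_def)
    let ?q' = "?q + length (rcode ?q (Suc s) b)"
    show "reach P (rtime \<rho> env b + 3) cf (ipost B (p + length (icode p s (ILe a b))) s im rm
        (ival \<rho> env (ILe a b)))"
    proof (rule reach_trans)
      show "reach P (rtime \<rho> env b) cf (rpost B ?q' (Suc s) im1 rm1 (rval \<rho> env b))"
        unfolding cf
        by (rule ILe.IH)
          (use ILe.prems A cf in \<open>auto simp: rpost_def Let_def elim: env_ok_frame\<close>)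
      fix cf2 assume B: "rpost B ?q' (Suc s) im1 rm1 (rval \<rho> env b) cf2"
      obtain im2 rm2 where cf2: "cf2 = (?q', im2, rm2)" using B by (auto simp: rpost_def)
      have code: "?q' < length P" "P ! ?q' = IConst s 1" "Suc ?q' < length P"
        "P ! Suc ?q' = JmpRLe s (Suc s) (?q' + 3)" "Suc (Suc ?q') < length P"
        "P ! Suc (Suc ?q') = IConst s 0"
        using ILe.prems(1) by (auto simp: Let_def add.assoc)
      have vals: "rm2 s = rval \<rho> env a" "rm2 (Suc s) = rval \<rho> env b"
        using A B cf cf2 by (auto simp: rpost_def frame_def)
      \<comment> \<open>The result is preset to 1 and a successful comparison jumps over the reset
        to 0. Integer and real registers are separate files, so writing integer register
        \<open>s\<close> leaves the operands intact.\<close>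
      show "reach P 3 cf2 (ipost B (p + length (icode p s (ILe a b))) s im rm
          (ival \<rho> env (ILe a b)))"
        unfolding cf2 numeral_3_eq_3
      proof (rule reach_step[OF code(1,2)], unfold exec.simps, rule reach_step[OF code(3,4)],
          cases "rval \<rho> env a \<le> rval \<rho> env b")
        case True
        then show "reach P (Suc 0) (exec (JmpRLe s (Suc s) (?q' + 3)) (Suc ?q', im2(s := 1), rm2))
            (ipost B (p + length (icode p s (ILe a b))) s im rm (ival \<rho> env (ILe a b)))"
          using A B cf cf2 vals ILe.prems
          by (auto intro!: reach_refl simp: rpost_def ipost_def frame_def Let_def)
      next
        case False
        have "reach P (Suc 0) (Suc (Suc ?q'), im2(s := 1), rm2)
            (ipost B (p + length (icode p s (ILe a b))) s im rm (ival \<rho> env (ILe a b)))"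
          by (rule reach_step[OF code(5,6)], rule reach_refl)
            (use False A B cf cf2 ILe.prems in
              \<open>auto simp: rpost_def ipost_def frame_def Let_def\<close>)
        with False vals
        show "reach P (Suc 0) (exec (JmpRLe s (Suc s) (?q' + 3)) (Suc ?q', im2(s := 1), rm2))
            (ipost B (p + length (icode p s (ILe a b))) s im rm (ival \<rho> env (ILe a b)))"
          by simp
      qed
    qed
  qed
next
  case (ISum x a b)
  let ?N = "ival \<rho> env a" and ?v = "\<lambda>i. ival \<rho> (env(x := i)) b"
  let ?q = "p + length (icode p s a)"
  let ?body = "icode (?q + 5) (s + 4) b"
  let ?q' = "?q + 5 + length ?body"
  let ?post = "ipost B (p + length (icode p s (ISum x a b))) s im rm (ival \<rho> env (ISum x a b))"
  \<comment> \<open>Register \<open>s + 1\<close> saves the old contents of the loop variable,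
    \<open>s + 2\<close> accumulates and \<open>s + 3\<close> holds the increment. The register
    \<open>Suc x\<close> lies below \<open>s\<close>, so during the loop the frame condition has to
    exclude it.\<close>
  define Inv where "Inv k = (\<lambda>(pc, im', rm'). pc = ?q + 4 \<and> im' s = int ?N
      \<and> im' (s + 1) = im (Suc x) \<and> im' (s + 2) = int (\<Sum>i<k. ?v i) \<and> im' (s + 3) = 1
      \<and> im' (Suc x) = int k \<and> (\<forall>y<s. y \<noteq> Suc x \<longrightarrow> im' y = im y)
      \<and> (\<forall>y. y < s \<or> B \<le> y \<longrightarrow> rm' y = rm y))" for k :: nat
  have x: "x < V" "Suc x < s" using ISum.prems by auto
  have code: "code_at P p (icode p s a)" "code_at P ?q [IConst (s + 2) 0, IAdd (s + 1) (s + 2) (Suc x), IConst (Suc x) 0, IConst (s + 3) 1]"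
    "?q + 4 < length P" "P ! (?q + 4) = JmpILe s (Suc x) (?q' + 3)"
    "code_at P (?q + 5) ?body"
    "code_at P ?q' [IAdd (s + 2) (s + 2) (s + 4), IAdd (Suc x) (Suc x) (s + 3)]"
    "?q' + 2 < length P" "P ! (?q' + 2) = Jmp (?q + 4)"
    "code_at P (?q' + 3) [IConst (s + 3) 0, IAdd s (s + 2) (s + 3), IAdd (Suc x) (s + 1) (s + 3)]"
    using ISum.prems(1) by (auto simp: Let_def algebra_simps eval_nat_numeral)
  show ?case
    unfolding itime.simps
  proof (rule reach_trans)
    show "reach P (itime \<rho> env a) (p, im, rm) (ipost B ?q s im rm ?N)"
      by (rule ISum.IH(1)) (use ISum.prems code in auto)
    fix cf assume A: "ipost B ?q s im rm ?N cf"
    obtain im1 rm1 where cf: "cf = (?q, im1, rm1)" using A by (auto simp: ipost_def)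
    have init: "reach P 4 cf (Inv 0)"
    proof -
      have "reach P (length [IConst (s + 2) 0, IAdd (s + 1) (s + 2) (Suc x), IConst (Suc x) 0, IConst (s + 3) 1]) cf (Inv 0)"
        unfolding cf
        by (rule reach_straight[OF code(2)])
          (use A cf x ISum.prems in \<open>auto simp: Inv_def ipost_def frame_def\<close>)
      then show ?thesis by (simp add: eval_nat_numeral)
    qed
    have loop: "reach P (1 + (itime \<rho> (env(x := k)) b + 3)) cf (Inv (Suc k))"
      if k: "k < ?N" and I: "Inv k cf" for k cf
    proof -
      obtain im2 rm2 where cf: "cf = (?q + 4, im2, rm2)" using I by (auto simp: Inv_def)
      note I' = I[unfolded Inv_def cf, simplified]
      have "reach P (itime \<rho> (env(x := k)) b + 3) (Suc (?q + 4), im2, rm2) (Inv (Suc k))"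
      proof (rule reach_trans)
        have pc: "Suc (?q + 4) = ?q + 5" by simp
        have "env_ok V B \<rho> (env(x := k)) im2 rm2"
          using ISum.prems x I' unfolding env_ok_def by auto
        then show "reach P (itime \<rho> (env(x := k)) b) (Suc (?q + 4), im2, rm2)
            (ipost B ?q' (s + 4) im2 rm2 (?v k))"
          unfolding pc by (intro ISum.IH(2)) (use ISum.prems code(5) in \<open>auto simp: fun_upd_def\<close>)
        fix cf3 assume C: "ipost B ?q' (s + 4) im2 rm2 (?v k) cf3"
        obtain im3 rm3 where cf3: "cf3 = (?q', im3, rm3)" using C by (auto simp: ipost_def)
        have "reach P (length [IAdd (s + 2) (s + 2) (s + 4), IAdd (Suc x) (Suc x) (s + 3)] + 1) cf3 (Inv (Suc k))"
        proof (rule reach_trans)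
          show "reach P (length [IAdd (s + 2) (s + 2) (s + 4), IAdd (Suc x) (Suc x) (s + 3)]) cf3
              (\<lambda>cf. cf = fold exec [IAdd (s + 2) (s + 2) (s + 4), IAdd (Suc x) (Suc x) (s + 3)] cf3)"
            unfolding cf3 by (rule reach_straight[OF code(6)]) auto
          fix cf4 assume D: "cf4 = fold exec [IAdd (s + 2) (s + 2) (s + 4), IAdd (Suc x) (Suc x) (s + 3)] cf3"
          obtain im4 rm4 where cf4: "cf4 = (?q' + 2, im4, rm4)"
            using D cf3 by (auto simp: eval_nat_numeral)
          have "Inv (Suc k) (?q + 4, im4, rm4)"
            using D C cf3 cf4 x I' ISum.prems by (auto simp: Inv_def ipost_def frame_def)
          then show "reach P 1 cf4 (Inv (Suc k))"
            unfolding cf4 One_nat_def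
            by (intro reach_step[OF code(7,8)]) (simp add: reach_refl)
        qed
        then show "reach P 3 cf3 (Inv (Suc k))" by (simp add: eval_nat_numeral)
      qed
      then show ?thesis
        unfolding cf plus_1_eq_Suc
        by (intro reach_step[OF code(3,4)]) (use I' k in simp)
    qed
    have final: "reach P 4 cf ?post" if I: "Inv ?N cf" for cf
    proof -
      obtain im2 rm2 where cf: "cf = (?q + 4, im2, rm2)" using I by (auto simp: Inv_def)
      note I' = I[unfolded Inv_def cf, simplified]
      \<comment> \<open>Adding the zero in \<open>s + 3\<close> acts as a move. Writing back the
        saved value of \<open>Suc x\<close> re-establishes the full frame condition.\<close>
      have "reach P (length [IConst (s + 3) 0, IAdd s (s + 2) (s + 3), IAdd (Suc x) (s + 1) (s + 3)]) (?q' + 3, im2, rm2) ?post"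
        by (rule reach_straight[OF code(9)])
          (use I' x ISum.prems in \<open>auto simp: ipost_def frame_def Let_def less_Suc_eq\<close>)
      then have "reach P (Suc (length [IConst (s + 3) 0, IAdd s (s + 2) (s + 3), IAdd (Suc x) (s + 1) (s + 3)])) cf ?post"
        unfolding cf by (intro reach_step[OF code(3,4)]) (use I' in simp)
      then show ?thesis by (simp add: eval_nat_numeral)
    qed
    show "reach P (4 + ((\<Sum>i<?N. 1 + (itime \<rho> (env(x := i)) b + 3)) + 4)) cf ?post"
      by (rule reach_trans[OF init], rule reach_trans[OF _ final],
        rule reach_loop[where I = Inv, OF _ loop])
  qed
next
  case (RIn a)
  let ?q = "p + length (icode p s a)"
  show ?case
    unfolding rtime.simps
  proof (rule reach_trans)
    show "reach P (itime \<rho> env a) (p, im, rm) (ipost B ?q s im rm (ival \<rho> env a))"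
      by (rule RIn.IH) (use RIn.prems in auto)
    fix cf assume A: "ipost B ?q s im rm (ival \<rho> env a) cf"
    obtain im1 rm1 where cf: "cf = (?q, im1, rm1)" using A by (auto simp: ipost_def)
    have code: "?q < length P" "P ! ?q = IAdd s s 0" "Suc ?q < length P" "P ! Suc ?q = RLoad s s"
      using RIn.prems(1) by auto
    have "env_ok V B \<rho> env im1 rm1"
      using A cf RIn.prems by (auto simp: ipost_def elim: env_ok_frame)
    then have "im1 s + im1 0 = int (ival \<rho> env a + B)"
        "rm1 (ival \<rho> env a + B) = \<rho> (ival \<rho> env a)"
      using A cf by (auto simp: ipost_def env_ok_def add.commute)
    then show "reach P 2 cf (rpost B (p + length (rcode p s (RIn a))) s im rm
        (rval \<rho> env (RIn a)))"
      unfolding cf numeral_2_eq_2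
      by (intro reach_step[OF code(1,2)], unfold exec.simps, intro reach_step[OF code(3,4)])
        (use A cf RIn.prems in
          \<open>auto intro!: reach_refl simp: rpost_def ipost_def frame_def nat_int_add\<close>)
  qed
next
  case (RCst k)
  have "reach P (length [RConst s k]) (p, im, rm)
      (rpost B (p + length (rcode p s (RCst k))) s im rm (rval \<rho> env (RCst k)))"
    by (rule reach_straight) (use RCst in \<open>auto simp: rpost_def frame_def\<close>)
  then show ?case by simp
next
  case (RPlus a b)
  let ?q = "p + length (rcode p s a)"
  let ?q' = "?q + length (rcode ?q (Suc s) b)"
  have "reach P (rtime \<rho> env a + (rtime \<rho> env b + 1)) (p, im, rm)
      (rpost B (Suc ?q') s im rm (rval \<rho> env a + rval \<rho> env b))"
    by (rule reach_binary[OF RPlus.IH(1) RPlus.IH(2), where i = "RAdd s s (Suc s)"])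
      (use RPlus.prems in \<open>auto elim: env_ok_frame\<close>)
  then show ?case by (simp add: add.assoc)
next
  case (RMinus a b)
  let ?q = "p + length (rcode p s a)"
  let ?q' = "?q + length (rcode ?q (Suc s) b)"
  have "reach P (rtime \<rho> env a + (rtime \<rho> env b + 1)) (p, im, rm)
      (rpost B (Suc ?q') s im rm (rval \<rho> env a - rval \<rho> env b))"
    by (rule reach_binary[OF RMinus.IH(1) RMinus.IH(2), where i = "RSub s s (Suc s)"])
      (use RMinus.prems in \<open>auto elim: env_ok_frame\<close>)
  then show ?case by (simp add: add.assoc)
next
  case (RTimes a b)
  let ?q = "p + length (rcode p s a)"
  let ?q' = "?q + length (rcode ?q (Suc s) b)"
  have "reach P (rtime \<rho> env a + (rtime \<rho> env b + 1)) (p, im, rm)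
      (rpost B (Suc ?q') s im rm (rval \<rho> env a * rval \<rho> env b))"
    by (rule reach_binary[OF RTimes.IH(1) RTimes.IH(2), where i = "RMul s s (Suc s)"])
      (use RTimes.prems in \<open>auto elim: env_ok_frame\<close>)
  then show ?case by (simp add: add.assoc)
next
  case (RSum x a b)
  let ?N = "ival \<rho> env a" and ?v = "\<lambda>i. rval \<rho> (env(x := i)) b"
  let ?q = "p + length (icode p s a)"
  let ?body = "rcode (?q + 6) (s + 4) b"
  let ?q' = "?q + 6 + length ?body"
  let ?post = "rpost B (p + length (rcode p s (RSum x a b))) s im rm (rval \<rho> env (RSum x a b))"
  \<comment> \<open>Here the accumulator is real register \<open>s\<close>, so integer register
    \<open>s + 2\<close> can remain 0 and serve the final move that restores
    \<open>Suc x\<close>.\<close>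
  define Inv where "Inv k = (\<lambda>(pc, im', rm'). pc = ?q + 5 \<and> im' s = int ?N
      \<and> im' (s + 1) = im (Suc x) \<and> im' (s + 2) = 0 \<and> rm' s = (\<Sum>i<k. ?v i) \<and> im' (s + 3) = 1
      \<and> im' (Suc x) = int k \<and> (\<forall>y<s. y \<noteq> Suc x \<longrightarrow> im' y = im y)
      \<and> (\<forall>y. y < s \<or> B \<le> y \<longrightarrow> rm' y = rm y))" for k :: nat
  have x: "x < V" "Suc x < s" using RSum.prems by auto
  have code: "code_at P p (icode p s a)" "code_at P ?q [IConst (s + 2) 0, IAdd (s + 1) (s + 2) (Suc x), IConst (Suc x) 0, IConst (s + 3) 1, RConst s 0]"
    "?q + 5 < length P" "P ! (?q + 5) = JmpILe s (Suc x) (?q' + 3)"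
    "code_at P (?q + 6) ?body"
    "code_at P ?q' [RAdd s s (s + 4), IAdd (Suc x) (Suc x) (s + 3)]"
    "?q' + 2 < length P" "P ! (?q' + 2) = Jmp (?q + 5)"
    "code_at P (?q' + 3) [IAdd (Suc x) (s + 1) (s + 2)]"
    using RSum.prems(1) by (auto simp: Let_def algebra_simps eval_nat_numeral)
  show ?case
    unfolding rtime.simps
  proof (rule reach_trans)
    show "reach P (itime \<rho> env a) (p, im, rm) (ipost B ?q s im rm ?N)"
      by (rule RSum.IH(1)) (use RSum.prems code in auto)
    fix cf assume A: "ipost B ?q s im rm ?N cf"
    obtain im1 rm1 where cf: "cf = (?q, im1, rm1)" using A by (auto simp: ipost_def)
    have init: "reach P 5 cf (Inv 0)"
    proof -
      have "reach P (length [IConst (s + 2) 0, IAdd (s + 1) (s + 2) (Suc x), IConst (Suc x) 0, IConst (s + 3) 1, RConst s 0]) cf (Inv 0)"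
        unfolding cf
        by (rule reach_straight[OF code(2)])
          (use A cf x RSum.prems in \<open>auto simp: Inv_def ipost_def frame_def\<close>)
      then show ?thesis by (simp add: eval_nat_numeral)
    qed
    have loop: "reach P (1 + (rtime \<rho> (env(x := k)) b + 3)) cf (Inv (Suc k))"
      if k: "k < ?N" and I: "Inv k cf" for k cf
    proof -
      obtain im2 rm2 where cf: "cf = (?q + 5, im2, rm2)" using I by (auto simp: Inv_def)
      note I' = I[unfolded Inv_def cf, simplified]
      have "reach P (rtime \<rho> (env(x := k)) b + 3) (Suc (?q + 5), im2, rm2) (Inv (Suc k))"
      proof (rule reach_trans)
        have pc: "Suc (?q + 5) = ?q + 6" by simp
        have "env_ok V B \<rho> (env(x := k)) im2 rm2"
          using RSum.prems x I' unfolding env_ok_def by auto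
        then show "reach P (rtime \<rho> (env(x := k)) b) (Suc (?q + 5), im2, rm2)
            (rpost B ?q' (s + 4) im2 rm2 (?v k))"
          unfolding pc by (intro RSum.IH(2)) (use RSum.prems code(5) in \<open>auto simp: fun_upd_def\<close>)
        fix cf3 assume C: "rpost B ?q' (s + 4) im2 rm2 (?v k) cf3"
        obtain im3 rm3 where cf3: "cf3 = (?q', im3, rm3)" using C by (auto simp: rpost_def)
        have "reach P (length [RAdd s s (s + 4), IAdd (Suc x) (Suc x) (s + 3)] + 1) cf3 (Inv (Suc k))"
        proof (rule reach_trans)
          show "reach P (length [RAdd s s (s + 4), IAdd (Suc x) (Suc x) (s + 3)]) cf3
              (\<lambda>cf. cf = fold exec [RAdd s s (s + 4), IAdd (Suc x) (Suc x) (s + 3)] cf3)"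
            unfolding cf3 by (rule reach_straight[OF code(6)]) auto
          fix cf4 assume D: "cf4 = fold exec [RAdd s s (s + 4), IAdd (Suc x) (Suc x) (s + 3)] cf3"
          obtain im4 rm4 where cf4: "cf4 = (?q' + 2, im4, rm4)"
            using D cf3 by (auto simp: eval_nat_numeral)
          have "Inv (Suc k) (?q + 5, im4, rm4)"
            using D C cf3 cf4 x I' RSum.prems by (auto simp: Inv_def rpost_def frame_def)
          then show "reach P 1 cf4 (Inv (Suc k))"
            unfolding cf4 One_nat_def
            by (intro reach_step[OF code(7,8)]) (simp add: reach_refl)
        qed
        then show "reach P 3 cf3 (Inv (Suc k))" by (simp add: eval_nat_numeral)
      qed
      then show ?thesis
        unfolding cf plus_1_eq_Suc
        by (intro reach_step[OF code(3,4)]) (use I' k in simp)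
    qed
    have final: "reach P 2 cf ?post" if I: "Inv ?N cf" for cf
    proof -
      obtain im2 rm2 where cf: "cf = (?q + 5, im2, rm2)" using I by (auto simp: Inv_def)
      note I' = I[unfolded Inv_def cf, simplified]
      have "reach P (length [IAdd (Suc x) (s + 1) (s + 2)]) (?q' + 3, im2, rm2) ?post"
        by (rule reach_straight[OF code(9)])
          (use I' x RSum.prems in \<open>auto simp: rpost_def frame_def Let_def less_Suc_eq\<close>)
      then have "reach P (Suc (length [IAdd (Suc x) (s + 1) (s + 2)])) cf ?post"
        unfolding cf by (intro reach_step[OF code(3,4)]) (use I' in simp)
      then show ?thesis by (simp add: eval_nat_numeral)
    qed
    show "reach P (5 + ((\<Sum>i<?N. 1 + (rtime \<rho> (env(x := i)) b + 3)) + 2)) cf ?post"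
      by (rule reach_trans[OF init], rule reach_trans[OF _ final],
        rule reach_loop[where I = Inv, OF _ loop])
  qed
qed

subsection \<open>Polynomial running time\<close>

text \<open>Both powers are at least 1, so the left side is at most
  \<open>8 * B ^ i * B ^ j\<close>, and \<open>8 \<le> B ^ 3\<close>. The 6 absorbs the constant
  overhead of every construct other than a sum.\<close>

lemma power_add_bound:
  fixes B :: nat
  assumes "2 \<le> B"
  shows "B ^ i + B ^ j + 6 \<le> B ^ (i + j + 3)"
proof -
  have 1: "1 \<le> B ^ i" "1 \<le> B ^ j" using assms by auto
  then have p: "B ^ i \<le> B ^ i * B ^ j" "B ^ j \<le> B ^ i * B ^ j" "1 \<le> B ^ i * B ^ j" by simp_all
  have "(2::nat) ^ 3 \<le> B ^ 3" using assms by (rule power_mono) simp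
  then have "B ^ i * B ^ j * 8 \<le> B ^ (i + j + 3)" by (simp add: power_add)
  with p show ?thesis by linarith
qed

text \<open>With \<open>A = B ^ i\<close> and \<open>C = (B ^ Suc i) ^ j\<close> the left side is at
  most \<open>5 * A + A * C + 8\<close>, hence at most \<open>16 * A * C\<close>, and
  \<open>16 \<le> B ^ 4\<close>. The 8 covers setup and clean-up of both kinds of sum.\<close>

lemma sum_power_bound:
  fixes B :: nat
  assumes "2 \<le> B" "N \<le> B ^ i" "\<And>k. k < N \<Longrightarrow> g k \<le> (B ^ Suc i) ^ j"
  shows "(\<Sum>k<N. g k) \<le> B ^ (i + Suc i * j + 4)"
    and "T \<le> B ^ i \<Longrightarrow> T + (\<Sum>k<N. 1 + (g k + 3)) + 8 \<le> B ^ (i + Suc i * j + 4)"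
proof -
  define A C where "A = B ^ i" and "C = (B ^ Suc i) ^ j"
  have "1 \<le> A" "1 \<le> C" using assms(1) by (auto simp: A_def C_def)
  then have p: "A \<le> A * C" "1 \<le> A * C" by simp_all
  have "(\<Sum>k<N. 1 + (g k + 3)) \<le> N * (4 + C)"
    using sum_bounded_above[of "{..<N}" "\<lambda>k. 1 + (g k + 3)" "4 + C"] assms(3) by (simp add: C_def)
  also have "\<dots> \<le> A * (4 + C)" using assms(2) by (intro mult_right_mono) (auto simp: A_def)
  finally have s: "(\<Sum>k<N. 1 + (g k + 3)) \<le> A * 4 + A * C" by (simp add: algebra_simps)
  have "(2::nat) ^ 4 \<le> B ^ 4" using assms(1) by (rule power_mono) simp
  then have "A * C * 16 \<le> A * C * B ^ 4" by simp
  also have "\<dots> = B ^ (i + Suc i * j + 4)"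
    unfolding A_def C_def by (simp only: power_add power_mult mult.assoc)
  finally have b: "A * C * 16 \<le> B ^ (i + Suc i * j + 4)" .
  have "(\<Sum>k<N. g k) \<le> (\<Sum>k<N. 1 + (g k + 3))" by (rule sum_mono) simp
  with s b p show "(\<Sum>k<N. g k) \<le> B ^ (i + Suc i * j + 4)" by linarith
  show "T + (\<Sum>k<N. 1 + (g k + 3)) + 8 \<le> B ^ (i + Suc i * j + 4)" if "T \<le> B ^ i"
    using that s b p unfolding A_def[symmetric] by linarith
qed

text \<open>Integer values are bounded together with the time since they determine the number of
  rounds; real values need no bound, as real operations have unit cost. The exponent depends on the
  expression only.\<close>

lemma time_polynomial:
  fixes e :: iexp and r :: rexp
  shows "\<exists>K. \<forall>\<rho> env B. 2 \<le> B \<longrightarrow> (\<forall>y. env y \<le> B)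
      \<longrightarrow> ival \<rho> env e \<le> B ^ K \<and> itime \<rho> env e \<le> B ^ K"
    and "\<exists>K. \<forall>\<rho> env B. 2 \<le> B \<longrightarrow> (\<forall>y. env y \<le> B) \<longrightarrow> rtime \<rho> env r \<le> B ^ K"
proof (induction e and r)
  case (ICst k)
  have "k \<le> B ^ k" if "2 \<le> B" for B :: nat
    using power_mono[OF that, of k] less_exp[of k] by linarith
  then show ?case by (intro exI[of _ k]) (auto intro: Suc_leI)
next
  case (IVar x)
  show ?case by (rule exI[of _ 1]) auto
next
  case (IPlus a b)
  then obtain i j where
    i: "\<And>\<rho> env B. 2 \<le> B \<Longrightarrow> \<forall>y. env y \<le> B
      \<Longrightarrow> ival \<rho> env a \<le> B ^ i \<and> itime \<rho> env a \<le> B ^ i" and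
    j: "\<And>\<rho> env B. 2 \<le> B \<Longrightarrow> \<forall>y. env y \<le> B
      \<Longrightarrow> ival \<rho> env b \<le> B ^ j \<and> itime \<rho> env b \<le> B ^ j" by metis
  show ?case
  proof (intro exI[of _ "i + j + 3"] allI impI)
    fix \<rho> and env :: "nat \<Rightarrow> nat" and B :: nat
    assume B: "2 \<le> B" "\<forall>y. env y \<le> B"
    show "ival \<rho> env (IPlus a b) \<le> B ^ (i + j + 3)
        \<and> itime \<rho> env (IPlus a b) \<le> B ^ (i + j + 3)"
      using i[OF B, of \<rho>] j[OF B, of \<rho>] power_add_bound[OF B(1), of i j]
      unfolding ival.simps itime.simps by linarith
  qed
next
  case (ISum x a b)
  then obtain i j where
    i: "\<And>\<rho> env B. 2 \<le> B \<Longrightarrow> \<forall>y. env y \<le> B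
      \<Longrightarrow> ival \<rho> env a \<le> B ^ i \<and> itime \<rho> env a \<le> B ^ i" and
    j: "\<And>\<rho> env B. 2 \<le> B \<Longrightarrow> \<forall>y. env y \<le> B
      \<Longrightarrow> ival \<rho> env b \<le> B ^ j \<and> itime \<rho> env b \<le> B ^ j" by metis
  show ?case
  proof (intro exI[of _ "i + Suc i * j + 4"] allI impI)
    fix \<rho> and env :: "nat \<Rightarrow> nat" and B :: nat
    assume B: "2 \<le> B" "\<forall>y. env y \<le> B"
    note a = i[OF B, of \<rho>]
    \<comment> \<open>The body runs in an environment whose loop variable may reach
      \<open>B ^ i\<close>. Its hypothesis is applied with the base \<open>B ^ Suc i\<close>, which
      dominates the old variables and the new one even for \<open>i = 0\<close>.\<close>
    have M: "B \<le> B ^ Suc i" "B ^ i \<le> B ^ Suc i" using B(1) by auto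
    have b: "ival \<rho> (env(x := k)) b \<le> (B ^ Suc i) ^ j \<and> itime \<rho> (env(x := k)) b \<le> (B ^ Suc i) ^ j"
      if "k < ival \<rho> env a" for k
    proof (rule j)
      show "2 \<le> B ^ Suc i" using B(1) M(1) by linarith
      have "k \<le> B ^ Suc i" using that a M(2) by linarith
      then show "\<forall>y. (env(x := k)) y \<le> B ^ Suc i" by (metis B(2) M(1) fun_upd_apply order_trans)
    qed
    show "ival \<rho> env (ISum x a b) \<le> B ^ (i + Suc i * j + 4)
        \<and> itime \<rho> env (ISum x a b) \<le> B ^ (i + Suc i * j + 4)"
      unfolding ival.simps itime.simps
      using sum_power_bound(1)[OF B(1) conjunct1[OF a], of "\<lambda>k. ival \<rho> (env(x := k)) b" j,
          OF conjunct1[OF b]]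
        sum_power_bound(2)[OF B(1) conjunct1[OF a], of "\<lambda>k. itime \<rho> (env(x := k)) b" j
          "itime \<rho> env a", OF conjunct2[OF b] conjunct2[OF a]]
      by linarith
  qed
next
  case (ILe a b)
  then obtain i j where
    i: "\<And>\<rho> env B. 2 \<le> B \<Longrightarrow> \<forall>y. env y \<le> B \<Longrightarrow> rtime \<rho> env a \<le> B ^ i" and
    j: "\<And>\<rho> env B. 2 \<le> B \<Longrightarrow> \<forall>y. env y \<le> B \<Longrightarrow> rtime \<rho> env b \<le> B ^ j" by metis
  show ?case
  proof (intro exI[of _ "i + j + 3"] allI impI)
    fix \<rho> and env :: "nat \<Rightarrow> nat" and B :: nat
    assume B: "2 \<le> B" "\<forall>y. env y \<le> B"
    have "ival \<rho> env (ILe a b) \<le> 1" by simp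
    then show "ival \<rho> env (ILe a b) \<le> B ^ (i + j + 3)
        \<and> itime \<rho> env (ILe a b) \<le> B ^ (i + j + 3)"
      using i[OF B, of \<rho>] j[OF B, of \<rho>] power_add_bound[OF B(1), of i j]
      unfolding itime.simps by linarith
  qed
next
  case (RIn a)
  then obtain i where
    i: "\<And>\<rho> env B. 2 \<le> B \<Longrightarrow> \<forall>y. env y \<le> B \<Longrightarrow> itime \<rho> env a \<le> B ^ i" by metis
  show ?case
  proof (intro exI[of _ "i + 0 + 3"] allI impI)
    fix \<rho> and env :: "nat \<Rightarrow> nat" and B :: nat
    assume B: "2 \<le> B" "\<forall>y. env y \<le> B"
    show "rtime \<rho> env (RIn a) \<le> B ^ (i + 0 + 3)"
      using i[OF B, of \<rho>] power_add_bound[OF B(1), of i 0]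
      unfolding rtime.simps by linarith
  qed
next
  case (RCst k)
  show ?case by (rule exI[of _ 0]) auto
next
  case (RPlus a b)
  then obtain i j where
    i: "\<And>\<rho> env B. 2 \<le> B \<Longrightarrow> \<forall>y. env y \<le> B \<Longrightarrow> rtime \<rho> env a \<le> B ^ i" and
    j: "\<And>\<rho> env B. 2 \<le> B \<Longrightarrow> \<forall>y. env y \<le> B \<Longrightarrow> rtime \<rho> env b \<le> B ^ j" by metis
  show ?case
  proof (intro exI[of _ "i + j + 3"] allI impI)
    fix \<rho> and env :: "nat \<Rightarrow> nat" and B :: nat
    assume B: "2 \<le> B" "\<forall>y. env y \<le> B"
    show "rtime \<rho> env (RPlus a b) \<le> B ^ (i + j + 3)"
      using i[OF B, of \<rho>] j[OF B, of \<rho>] power_add_bound[OF B(1), of i j]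
      unfolding rtime.simps by linarith
  qed
next
  case (RMinus a b)
  then obtain i j where
    i: "\<And>\<rho> env B. 2 \<le> B \<Longrightarrow> \<forall>y. env y \<le> B \<Longrightarrow> rtime \<rho> env a \<le> B ^ i" and
    j: "\<And>\<rho> env B. 2 \<le> B \<Longrightarrow> \<forall>y. env y \<le> B \<Longrightarrow> rtime \<rho> env b \<le> B ^ j" by metis
  show ?case
  proof (intro exI[of _ "i + j + 3"] allI impI)
    fix \<rho> and env :: "nat \<Rightarrow> nat" and B :: nat
    assume B: "2 \<le> B" "\<forall>y. env y \<le> B"
    show "rtime \<rho> env (RMinus a b) \<le> B ^ (i + j + 3)"
      using i[OF B, of \<rho>] j[OF B, of \<rho>] power_add_bound[OF B(1), of i j]
      unfolding rtime.simps by linarith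
  qed
next
  case (RTimes a b)
  then obtain i j where
    i: "\<And>\<rho> env B. 2 \<le> B \<Longrightarrow> \<forall>y. env y \<le> B \<Longrightarrow> rtime \<rho> env a \<le> B ^ i" and
    j: "\<And>\<rho> env B. 2 \<le> B \<Longrightarrow> \<forall>y. env y \<le> B \<Longrightarrow> rtime \<rho> env b \<le> B ^ j" by metis
  show ?case
  proof (intro exI[of _ "i + j + 3"] allI impI)
    fix \<rho> and env :: "nat \<Rightarrow> nat" and B :: nat
    assume B: "2 \<le> B" "\<forall>y. env y \<le> B"
    show "rtime \<rho> env (RTimes a b) \<le> B ^ (i + j + 3)"
      using i[OF B, of \<rho>] j[OF B, of \<rho>] power_add_bound[OF B(1), of i j]
      unfolding rtime.simps by linarith
  qed
next
  case (RSum x a b)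
  then obtain i j where
    i: "\<And>\<rho> env B. 2 \<le> B \<Longrightarrow> \<forall>y. env y \<le> B
      \<Longrightarrow> ival \<rho> env a \<le> B ^ i \<and> itime \<rho> env a \<le> B ^ i" and
    j: "\<And>\<rho> env B. 2 \<le> B \<Longrightarrow> \<forall>y. env y \<le> B \<Longrightarrow> rtime \<rho> env b \<le> B ^ j" by metis
  show ?case
  proof (intro exI[of _ "i + Suc i * j + 4"] allI impI)
    fix \<rho> and env :: "nat \<Rightarrow> nat" and B :: nat
    assume B: "2 \<le> B" "\<forall>y. env y \<le> B"
    note a = i[OF B, of \<rho>]
    have M: "B \<le> B ^ Suc i" "B ^ i \<le> B ^ Suc i" using B(1) by auto
    have b: "rtime \<rho> (env(x := k)) b \<le> (B ^ Suc i) ^ j" if "k < ival \<rho> env a" for k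
    proof (rule j)
      show "2 \<le> B ^ Suc i" using B(1) M(1) by linarith
      have "k \<le> B ^ Suc i" using that a M(2) by linarith
      then show "\<forall>y. (env(x := k)) y \<le> B ^ Suc i" by (metis B(2) M(1) fun_upd_apply order_trans)
    qed
    show "rtime \<rho> env (RSum x a b) \<le> B ^ (i + Suc i * j + 4)"
      unfolding rtime.simps
      using sum_power_bound(2)[OF B(1) conjunct1[OF a], of "\<lambda>k. rtime \<rho> (env(x := k)) b" j
          "itime \<rho> env a", OF b conjunct2[OF a]]
      by linarith
  qed
qed

section \<open>Relocating the input and running the compiled code\<close>

text \<open>Integer registers cannot be multiplied; as \<open>d\<close> is constant,
  \<open>d * (n + m)\<close> is computed by unrolled additions.\<close>

lemma fold_exec_add_loop:
  "fold exec (concat (replicate d [IAdd 0 0 1, IAdd 0 0 2])) (p, im, rm) =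
    (p + 2 * d, im(0 := im 0 + int d * (im 1 + im 2)), rm)"
  by (induction d arbitrary: p im) (auto simp: algebra_simps)

text \<open>The real registers with small numbers hold part of the input, so the input is first
  copied from \<open>[0, B)\<close> to \<open>[B, 2B)\<close>, where \<open>B\<close> exceeds all the registers used later;
  saving register 0 frees the one register that the copying needs.\<close>
definition copy_code :: "nat \<Rightarrow> nat \<Rightarrow> instr list" where
  "copy_code d S =
     ([IConst 0 (int S), IAdd 0 0 1] @ concat (replicate d [IAdd 0 0 1, IAdd 0 0 2]) @
      [RStore 0 0, IConst 3 1, IConst 4 1]) @
     [JmpILe 0 3 (2 * d + 11), RLoad 0 3, IAdd 5 0 3, RStore 0 5, IAdd 3 3 4, Jmp (2 * d + 5)]"

lemma length_copy_code: "length (copy_code d S) = 2 * d + 11"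
  by (simp add: copy_code_def length_concat sum_list_replicate)

text \<open>The last input cell is \<open>n + d * (n + m)\<close>, below \<open>B\<close> because
  \<open>S > 0\<close>. The range \<open>[0, 2 * B]\<close> of all integer registers matters later:
  whatever copying leaves behind becomes the initial value of variables, which must be natural and
  bounded for the time estimate.\<close>

lemma copy_code_correct:
  fixes d n m S :: nat
  defines "B \<equiv> S + n + d * (n + m)"
  assumes code: "code_at P 0 (copy_code d S)" and "S > 0" "d > 0"
    and \<rho>: "\<And>a. a > n + d * (n + m) \<Longrightarrow> \<rho> a = 0"
    and im: "im 1 = int n" "im 2 = int m" "\<And>y. y > 2 \<Longrightarrow> im y = 0"
  shows "reach P (2 * d + 6 + 6 * B) (0, im, \<rho>) (\<lambda>(pc, im', rm'). pc = 2 * d + 11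
    \<and> im' 0 = int B \<and> im' 1 = int n \<and> im' 2 = int m \<and> (\<forall>y. 0 \<le> im' y \<and> im' y \<le> 2 * int B)
    \<and> (\<forall>a. rm' (B + a) = \<rho> a))"
proof -
  let ?A = "[IConst 0 (int S), IAdd 0 0 1] @ concat (replicate d [IAdd 0 0 1, IAdd 0 0 2]) @
      [RStore 0 0, IConst 3 1, IConst 4 1]"
  let ?q = "2 * d + 5"
  have B: "B > 0" "n \<le> B" using assms(3) by (auto simp: B_def)
  have m: "m \<le> B"
    using \<open>d > 0\<close> by (cases d) (auto simp: B_def)
  have len: "length ?A = ?q" by (simp add: length_concat sum_list_replicate)
  have cA: "code_at P 0 ?A" and cL: "code_at P ?q [JmpILe 0 3 (2 * d + 11), RLoad 0 3, IAdd 5 0 3,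
      RStore 0 5, IAdd 3 3 4, Jmp (2 * d + 5)]"
    using iffD1[OF code_at_append code[unfolded copy_code_def]] unfolding len add_0
    by (blast, blast)
  \<comment> \<open>Cell 0 is copied before the loop, so after \<open>k\<close> rounds cells
    \<open>0..k\<close> are in place. Real register 0 is the transfer register and is excluded from
    the preserved originals.\<close>
  define Inv where "Inv k = (\<lambda>(pc, im' :: nat \<Rightarrow> int, rm'). pc = ?q \<and> im' 0 = int B \<and> im' 1 = int n
      \<and> im' 2 = int m \<and> im' 3 = int (Suc k) \<and> im' 4 = 1 \<and> 0 \<le> im' 5 \<and> im' 5 \<le> 2 * int B
      \<and> (\<forall>y>5. im' y = 0) \<and> (\<forall>a. 0 < a \<longrightarrow> a < B \<longrightarrow> rm' a = \<rho> a)
      \<and> (\<forall>a. rm' (B + a) = (if a \<le> k then \<rho> a else 0)))" for k :: nat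
  have \<rho>B: "\<rho> a = 0" if "a \<ge> B" for a using that assms(3) by (intro \<rho>) (simp add: B_def)
  have init: "reach P ?q (0, im, \<rho>) (Inv 0)"
    unfolding len[symmetric]
  proof (rule reach_straight[OF cA])
    show "\<forall>i\<in>set ?A. straight i" by auto
    have "fold exec ?A (0, im, \<rho>) = (?q, im(0 := int B, 3 := 1, 4 := 1), \<rho>(B := \<rho> 0))"
      using im by (simp add: fold_exec_add_loop[unfolded One_nat_def] B_def algebra_simps)
        (simp add: nat_add_distrib nat_mult_distrib algebra_simps flip: of_nat_add of_nat_mult)
    then show "Inv 0 (fold exec ?A (0, im, \<rho>))"
      using im B(1) \<rho>B by (auto simp: Inv_def)
  qed
  have loop: "reach P 6 cf (Inv (Suc k))" if k: "k < B - 1" and I: "Inv k cf" for k cf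
  proof -
    obtain im2 rm2 where cf: "cf = (?q, im2, rm2)" using I by (auto simp: Inv_def)
    note I' = I[unfolded Inv_def cf, simplified]
    let ?im = "im2(5 := int (B + Suc k), 3 := int (Suc (Suc k)))"
    let ?rm = "rm2(0 := \<rho> (Suc k), B + Suc k := \<rho> (Suc k))"
    have vals: "im2 0 = int B" "im2 3 = int (Suc k)" "im2 4 = 1" "rm2 (Suc k) = \<rho> (Suc k)"
      using I' k by auto
    have 1: "reach P (length [RLoad 0 3, IAdd 5 0 3, RStore 0 5, IAdd 3 3 4])
        (?q + 1, im2, rm2) (\<lambda>cf. cf = (?q + 5, ?im, ?rm))"
    proof (rule reach_straight)
      show "code_at P (?q + 1) [RLoad 0 3, IAdd 5 0 3, RStore 0 5, IAdd 3 3 4]"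
        using cL by (simp add: eval_nat_numeral)
      have "nat (int B + int (Suc k)) = B + Suc k" "nat (int (Suc k)) = Suc k" by linarith+
      then show "fold exec [RLoad 0 3, IAdd 5 0 3, RStore 0 5, IAdd 3 3 4] (?q + 1, im2, rm2) =
          (?q + 5, ?im, ?rm)"
        using vals by (simp add: algebra_simps)
    qed auto
    have 2: "reach P (Suc 0) (?q + 5, ?im, ?rm) (\<lambda>cf. cf = (?q, ?im, ?rm))"
      by (rule reach_step[of _ _ "Jmp ?q"], use cL in \<open>simp_all add: eval_nat_numeral\<close>)
        (simp add: reach_refl)
    have "reach P (Suc (4 + Suc 0)) cf (\<lambda>cf. cf = (?q, ?im, ?rm))"
      unfolding cf
    proof (rule reach_step)
      show "?q < length P" "P ! ?q = JmpILe 0 3 (2 * d + 11)" using cL by auto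
      have "reach P (4 + Suc 0) (?q + 1, im2, rm2) (\<lambda>cf. cf = (?q, ?im, ?rm))"
        by (rule reach_trans[of _ _ _ "\<lambda>cf. cf = (?q + 5, ?im, ?rm)"])
          (use 1 2 in \<open>simp_all add: eval_nat_numeral\<close>)
      then show "reach P (4 + Suc 0) (exec (JmpILe 0 3 (2 * d + 11)) (?q, im2, rm2))
          (\<lambda>cf. cf = (?q, ?im, ?rm))"
        using vals k by (simp add: less_diff_conv)
    qed
    then have ex: "reach P 6 cf (\<lambda>cf. cf = (?q, ?im, ?rm))" by simp
    have "Inv (Suc k) (?q, ?im, ?rm)"
      using I' k by (auto simp: Inv_def)
    with ex show ?thesis by (auto elim!: reach_mono)
  qed
  let ?Q = "\<lambda>(pc, im' :: nat \<Rightarrow> int, rm'). pc = 2 * d + 11 \<and> im' 0 = int B \<and> im' 1 = int n \<and> im' 2 = int m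
    \<and> (\<forall>y. 0 \<le> im' y \<and> im' y \<le> 2 * int B) \<and> (\<forall>a. rm' (B + a) = \<rho> a)"
  have final: "reach P 1 cf ?Q" if I: "Inv (B - 1) cf" for cf
  proof -
    obtain im2 rm2 where cf: "cf = (?q, im2, rm2)" using I by (auto simp: Inv_def)
    note I' = I[unfolded Inv_def cf, simplified]
    have range: "0 \<le> im2 y \<and> im2 y \<le> 2 * int B" for y
    proof -
      consider "y = 0" | "y = 1" | "y = 2" | "y = 3" | "y = 4" | "y = 5" | "y > 5" by linarith
      then show ?thesis using I' B m by cases auto
    qed
    have "reach P (Suc 0) cf ?Q"
      unfolding cf
    proof (rule reach_step)
      show "?q < length P" "P ! ?q = JmpILe 0 3 (2 * d + 11)" using cL by auto
      show "reach P 0 (exec (JmpILe 0 3 (2 * d + 11)) (?q, im2, rm2)) ?Q"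
        by (rule reach_refl) (use I' B \<rho>B range in auto)
    qed
    then show ?thesis by simp
  qed
  have "reach P (?q + ((\<Sum>k<B - 1. 6) + 1)) (0, im, \<rho>) ?Q"
    by (rule reach_trans[OF init], rule reach_trans[OF _ final],
        rule reach_loop[where I = Inv, OF _ loop])
  then show ?thesis by (rule reach_mono) (use B in auto)
qed

text \<open>Only variables 0 and 1 of the environment are known; an expression used here must have a
  value that does not depend on the others.\<close>

lemma ival_decidable:
  fixes e :: iexp and d :: nat
  assumes "d > 0"
  shows "\<exists>P K. \<forall>n m \<rho> im.
     (\<forall>a > n + d * (n + m). \<rho> a = 0) \<and> im 1 = int n \<and> im 2 = int m \<and> (\<forall>y>2. im y = 0) \<longrightarrow>
     (\<exists>t env. t \<le> K * (n + m + 1) ^ K \<and> halted P (run P t (0, im, \<rho>)) \<and>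
        env 0 = n \<and> env 1 = m \<and> fst (snd (run P t (0, im, \<rho>))) 0 = int (ival \<rho> env e))"
proof -
  obtain k where k: "\<And>\<rho> env B. 2 \<le> B \<Longrightarrow> \<forall>y. env y \<le> B \<Longrightarrow> itime \<rho> env e \<le> B ^ k"
    using time_polynomial(1)[of e] by metis
  define V where "V = iwidth e"
  define s where "s = Suc V"
  define S where "S = s + iwidth e"
  define p where "p = 2 * d + 11"
  define c where "c = icode p s e"
  define P where "P = copy_code d S @ c @ [IConst (Suc s) 0, IAdd 0 s (Suc s), Halt]"
  \<comment> \<open>Chosen so that \<open>C * (n + m + 1)\<close> bounds \<open>2 * B\<close>, hence
    every initial variable, and is at least 2.\<close>
  define C where "C = 2 * (S + d + 1)"
  \<comment> \<open>One number that is large enough both as the coefficient and as the exponent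
    \<open>k + 1\<close>.\<close>
  define K where "K = (2 * d + 8 + 6 * C + C ^ k) + (k + 1)"
  have whole: "code_at P 0 P" by (simp add: code_at_def)
  have code: "code_at P 0 (copy_code d S)" "code_at P p c"
    "code_at P (p + length c) [IConst (Suc s) 0, IAdd 0 s (Suc s)]"
    "P ! (p + length c + 2) = Halt"
    \<comment> \<open>The lifted equation unfolds \<open>P\<close> only as the code fragment, not as
      the program that contains it.\<close>
    using whole[unfolded P_def[THEN arg_cong[of _ _ "code_at P 0"]]]
    by (simp_all add: length_copy_code p_def)
  show ?thesis
  proof (rule exI[of _ P], rule exI[of _ K], intro allI impI, elim conjE)
    fix n m :: nat and \<rho> :: "nat \<Rightarrow> real" and im :: "nat \<Rightarrow> int"
    assume \<rho>: "\<forall>a>n + d * (n + m). \<rho> a = 0"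
      and im: "im 1 = int n" "im 2 = int m" "\<forall>y>2. im y = 0"
    define B where "B = S + n + d * (n + m)"
    define M where "M = n + m + 1"
    have CM: "2 * B \<le> C * M" "2 \<le> C * M" and M1: "1 \<le> M"
      by (auto simp: B_def C_def M_def algebra_simps)
    let ?Q = "\<lambda>(pc, im', rm' :: nat \<Rightarrow> real). pc = p + length c + 2 \<and>
      (\<exists>env. env 0 = n \<and> env 1 = m \<and> im' 0 = int (ival \<rho> env e))"
    have "reach P ((2 * d + 6 + 6 * B) + ((C * M) ^ k + 2)) (0, im, \<rho>) ?Q"
    proof (rule reach_trans)
      show "reach P (2 * d + 6 + 6 * B) (0, im, \<rho>) (\<lambda>(pc, im', rm'). pc = 2 * d + 11
        \<and> im' 0 = int B \<and> im' 1 = int n \<and> im' 2 = int m \<and> (\<forall>y. 0 \<le> im' y \<and> im' y \<le> 2 * int B)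
        \<and> (\<forall>a. rm' (B + a) = \<rho> a))"
        unfolding B_def
        by (rule copy_code_correct[OF code(1)])
          (use \<rho> im assms in \<open>auto simp: S_def s_def\<close>)
      fix cf :: config
      assume "case cf of (pc, im', rm') \<Rightarrow> pc = 2 * d + 11
        \<and> im' 0 = int B \<and> im' 1 = int n \<and> im' 2 = int m \<and> (\<forall>y. 0 \<le> im' y \<and> im' y \<le> 2 * int B)
        \<and> (\<forall>a. rm' (B + a) = \<rho> a)"
      then obtain im1 rm1 where cf: "cf = (p, im1, rm1)" "im1 0 = int B" "im1 1 = int n"
        "im1 2 = int m" "\<And>y. 0 \<le> im1 y" "\<And>y. im1 y \<le> 2 * int B" "\<And>a. rm1 (B + a) = \<rho> a"
        by (auto simp: p_def)
      define env where "env y = nat (im1 (Suc y))" for y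
      have env: "env 0 = n" "env 1 = m"
        using cf(3,4) by (simp_all add: env_def eval_nat_numeral)
      have "env y \<le> C * M" for y
        using cf(6)[of "Suc y"] CM(1) unfolding env_def by linarith
      then have T: "itime \<rho> env e \<le> (C * M) ^ k" using CM(2) by (intro k) auto
      show "reach P ((C * M) ^ k + 2) cf ?Q"
      proof (rule reach_trans)
        have "reach P (itime \<rho> env e) (p, im1, rm1)
            (ipost B (p + length (icode p s e)) s im1 rm1 (ival \<rho> env e))"
          by (rule code_correct(1)[where V = V])
            (use cf code(2) in
              \<open>auto simp: c_def V_def s_def B_def S_def env_ok_def env_def\<close>)
        then show "reach P ((C * M) ^ k) cf (ipost B (p + length c) s im1 rm1 (ival \<rho> env e))"
          unfolding cf(1) c_def using T by (rule reach_mono)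
        fix cf2 assume "ipost B (p + length c) s im1 rm1 (ival \<rho> env e) cf2"
        then obtain im2 rm2 where cf2: "cf2 = (p + length c, im2, rm2)"
          "im2 s = int (ival \<rho> env e)" by (auto simp: ipost_def)
        have "reach P (length [IConst (Suc s) 0, IAdd 0 s (Suc s)]) cf2 ?Q"
          unfolding cf2(1)
          by (rule reach_straight[OF code(3)]) (use cf2(2) env in auto)
        then show "reach P 2 cf2 ?Q" by (simp add: eval_nat_numeral)
      qed
    qed
    then obtain t where t: "t \<le> (2 * d + 6 + 6 * B) + ((C * M) ^ k + 2)" "?Q (run P t (0, im, \<rho>))"
      unfolding reach_def by (elim exE conjE) (rule that)
    have "t \<le> (2 * d + 8) + 6 * C * M + C ^ k * M ^ k"
      using t(1) CM(1) by (simp add: power_mult_distrib)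
    also have "\<dots> \<le> (2 * d + 8) * M ^ Suc k + 6 * C * M ^ Suc k + C ^ k * M ^ Suc k"
    proof (intro add_mono mult_left_mono)
      show "2 * d + 8 \<le> (2 * d + 8) * M ^ Suc k" using M1 by simp
      show "M \<le> M ^ Suc k" "M ^ k \<le> M ^ Suc k" using M1 by auto
    qed auto
    also have "\<dots> = (2 * d + 8 + 6 * C + C ^ k) * M ^ Suc k" by (simp only: distrib_right)
    also have "\<dots> \<le> K * M ^ K"
      using M1 by (intro mult_mono power_increasing) (auto simp: K_def)
    finally have "t \<le> K * (n + m + 1) ^ K" by (simp add: M_def)
    moreover have "halted P (run P t (0, im, \<rho>))"
      using t(2) code(4) by (auto simp: halted_def)
    moreover obtain env where "env 0 = n" "env 1 = m"
      "fst (snd (run P t (0, im, \<rho>))) 0 = int (ival \<rho> env e)"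
      using t(2) by auto
    ultimately show "\<exists>t env. t \<le> K * (n + m + 1) ^ K \<and> halted P (run P t (0, im, \<rho>)) \<and>
        env 0 = n \<and> env 1 = m \<and> fst (snd (run P t (0, im, \<rho>))) 0 = int (ival \<rho> env e)"
      by blast
  qed
qed

subsection \<open>Rounding down to critical values\<close>

lemma linf_dist_le_iff: "d > 0 \<Longrightarrow> linf_dist d x y \<le> e \<longleftrightarrow> (\<forall>k<d. \<bar>x k - y k\<bar> \<le> e)"
  unfolding linf_dist_def by (subst Max_le_iff) auto

lemma le_linf_dist_iff: "d > 0 \<Longrightarrow> e \<le> linf_dist d x y \<longleftrightarrow> (\<exists>k<d. e \<le> \<bar>x k - y k\<bar>)"
  unfolding linf_dist_def by (subst Max_ge_iff) auto

lemma linf_dist_Suc: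
  "d > 0 \<Longrightarrow> linf_dist (Suc d) x y = max (linf_dist d x y) \<bar>x d - y d\<bar>"
  unfolding linf_dist_def by (simp add: atLeast0_lessThan_Suc max.commute)

lemma linf_dist_cong:
  "(\<And>k. k < d \<Longrightarrow> x k = x' k) \<Longrightarrow> (\<And>k. k < d \<Longrightarrow> y k = y' k)
    \<Longrightarrow> linf_dist d x y = linf_dist d x' y'"
  unfolding linf_dist_def by (intro arg_cong[of _ _ Max] image_cong) auto

lemma round_down:
  fixes r :: "nat \<Rightarrow> nat \<Rightarrow> real"
  assumes "d > 0" "linf_dist d x a \<le> eps"
  shows "\<exists>y. (\<forall>k<d. y k = a k - eps \<or>
          (\<exists>i<m. \<exists>j<n. y k = v i k - r i j \<or> y k = v i k + r i j)) \<and>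
      linf_dist d y a \<le> eps \<and>
      (\<forall>i<m. \<forall>j<n. r i j \<le> linf_dist d (v i) x \<longrightarrow> r i j \<le> linf_dist d (v i) y)"
proof -
  define C where "C k = insert (a k - eps) ((\<lambda>(i, j). v i k - r i j) ` ({..<m} \<times> {..<n})
      \<union> (\<lambda>(i, j). v i k + r i j) ` ({..<m} \<times> {..<n}))" for k
  define y where "y k = Max {z \<in> C k. z \<le> x k}" for k
  have x: "\<bar>x k - a k\<bar> \<le> eps" if "k < d" for k
    using assms that by (simp add: linf_dist_le_iff)
  have fin: "finite {z \<in> C k. z \<le> x k}" for k by (simp add: C_def)
  have ne: "{z \<in> C k. z \<le> x k} \<noteq> {}" if "k < d" for k
    using x[OF that] by (auto simp: C_def intro!: exI[of _ "a k - eps"])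
  have y: "y k \<in> C k" "y k \<le> x k" if "k < d" for k
    using Max_in[OF fin ne[OF that]] by (auto simp: y_def)
  have max: "z \<le> y k" if "z \<in> C k" "z \<le> x k" for z k
    unfolding y_def by (rule Max_ge) (use fin that in auto)
  show ?thesis
  proof (intro exI[of _ y] conjI allI impI)
    fix k assume "k < d"
    then show "y k = a k - eps \<or> (\<exists>i<m. \<exists>j<n. y k = v i k - r i j \<or> y k = v i k + r i j)"
      using y(1)[of k] by (auto simp: C_def)
  next
    have "\<bar>y k - a k\<bar> \<le> eps" if "k < d" for k
    proof -
      have "a k - eps \<le> y k"
        by (rule max) (use x[OF that] in \<open>auto simp: C_def\<close>)
      with y(2)[OF that] x[OF that] show ?thesis by linarith
    qed
    then show "linf_dist d y a \<le> eps" using assms(1) by (simp add: linf_dist_le_iff)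
  next
    fix i j assume ij: "i < m" "j < n" "r i j \<le> linf_dist d (v i) x"
    then obtain k where k: "k < d" "r i j \<le> \<bar>v i k - x k\<bar>"
      using assms(1) by (auto simp: le_linf_dist_iff)
    \<comment> \<open>Either \<open>x k \<le> v i k - r i j\<close>, which survives since
      \<open>y k \<le> x k\<close>, or \<open>v i k + r i j \<le> x k\<close>, and then this
      threshold competes in the maximum defining \<open>y k\<close>.\<close>
    have "v i k + r i j \<in> C k" using ij by (auto simp: C_def)
    then have "r i j \<le> \<bar>v i k - y k\<bar>"
      using k y(2)[OF k(1)] max[of "v i k + r i j" k] by linarith
    then show "r i j \<le> linf_dist d (v i) y" using k(1) assms(1) by (auto simp: le_linf_dist_iff)
  qed
qed

lemma rank_bounds: "j < n \<Longrightarrow> 1 \<le> rank d n p v i j \<and> rank d n p v i j \<le> n"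
proof -
  assume "j < n"
  have "card {j' \<in> {0..<n}. j' \<noteq> j \<and> prefers d p v i j' j} \<le> card ({0..<n} - {j})"
    by (rule card_mono) auto
  then show ?thesis using \<open>j < n\<close> by (simp add: rank_def)
qed

text \<open>Rivals do not move, so only comparisons with the target change. Being tied counts as
  being behind, so \<open>far\<close> says that no rival loses its precedence over the target: the
  rank number of the target can only grow and that of a rival only shrink.\<close>

lemma score_farther:
  assumes f: "\<And>s t. 1 \<le> s \<Longrightarrow> s \<le> t \<Longrightarrow> t \<le> n \<Longrightarrow> f t \<le> f s" and "n > 0"
    and far: "\<And>i j. i < m \<Longrightarrow> j < n \<Longrightarrow> linf_dist d (v i) (c j) \<le> linf_dist d (v i) x
      \<Longrightarrow> linf_dist d (v i) (c j) \<le> linf_dist d (v i) y"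
  shows "score d n m f (c(0 := y)) v 0 \<le> score d n m f (c(0 := x)) v 0"
    and "j \<in> {1..<n} \<Longrightarrow> score d n m f (c(0 := x)) v j \<le> score d n m f (c(0 := y)) v j"
proof -
  have "rank d n (c(0 := x)) v i 0 \<le> rank d n (c(0 := y)) v i 0" if "i < m" for i
    unfolding rank_def
    by (intro add_left_mono card_mono) (use far[OF that] in \<open>force simp: prefers_def\<close>)+
  then show "score d n m f (c(0 := y)) v 0 \<le> score d n m f (c(0 := x)) v 0"
    unfolding score_def using rank_bounds \<open>n > 0\<close> by (intro sum_mono f) auto
next
  assume j: "j \<in> {1..<n}"
  have "rank d n (c(0 := y)) v i j \<le> rank d n (c(0 := x)) v i j" if "i < m" for i
  proof -
    have "linf_dist d (v i) y < linf_dist d (v i) (c j)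
        \<Longrightarrow> linf_dist d (v i) x < linf_dist d (v i) (c j)"
      using far[OF that, of j] j by (meson atLeastLessThan_iff not_le)
    then show ?thesis
      unfolding rank_def using j
      by (intro add_left_mono card_mono) (auto simp: prefers_def split: if_splits)
  qed
  then show "score d n m f (c(0 := x)) v j \<le> score d n m f (c(0 := y)) v j"
    unfolding score_def using rank_bounds j by (intro sum_mono f) auto
qed

subsection \<open>The search as an expression\<close>

text \<open>A real sum of \<open>a\<close> ones. It lets integer tests be reduced to
  \<open>ILe\<close>, which compares reals.\<close>

definition toR :: "iexp \<Rightarrow> rexp" where
  "toR a = RSum 2 a (RCst 1)"

definition notE :: "iexp \<Rightarrow> iexp" where
  "notE a = ILe (toR a) (RCst 0)"

definition andE :: "iexp \<Rightarrow> iexp \<Rightarrow> iexp" where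
  "andE a b = notE (IPlus (notE a) (notE b))"

text \<open>Any nonzero value counts as true; double negation normalises it to 1.\<close>

definition orE :: "iexp \<Rightarrow> iexp \<Rightarrow> iexp" where
  "orE a b = notE (notE (IPlus a b))"

definition eqE :: "iexp \<Rightarrow> iexp \<Rightarrow> iexp" where
  "eqE a b = andE (ILe (toR a) (toR b)) (ILe (toR b) (toR a))"

definition ifE :: "iexp \<Rightarrow> rexp \<Rightarrow> rexp \<Rightarrow> rexp" where
  "ifE a x y = RPlus (RTimes (toR (notE (notE a))) x) (RTimes (toR (notE a)) y)"

definition absE :: "rexp \<Rightarrow> rexp" where
  "absE x = ifE (ILe (RCst 0) x) x (RMinus (RCst 0) x)"

definition maxE :: "rexp \<Rightarrow> rexp \<Rightarrow> rexp" where
  "maxE x y = ifE (ILe x y) y x"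

definition mulE :: "iexp \<Rightarrow> nat \<Rightarrow> iexp" where
  "mulE a k = ISum 2 a (ICst k)"

lemma eval_simps [simp]:
  "rval \<rho> env (toR a) = real (ival \<rho> env a)"
  "ival \<rho> env (notE a) = of_bool (ival \<rho> env a = 0)"
  "ival \<rho> env (andE a b) = of_bool (ival \<rho> env a \<noteq> 0 \<and> ival \<rho> env b \<noteq> 0)"
  "ival \<rho> env (orE a b) = of_bool (ival \<rho> env a \<noteq> 0 \<or> ival \<rho> env b \<noteq> 0)"
  "ival \<rho> env (eqE a b) = of_bool (ival \<rho> env a = ival \<rho> env b)"
  "rval \<rho> env (ifE a x y) = (if ival \<rho> env a \<noteq> 0 then rval \<rho> env x else rval \<rho> env y)"
  "rval \<rho> env (absE x) = \<bar>rval \<rho> env x\<bar>"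
  "rval \<rho> env (maxE x y) = max (rval \<rho> env x) (rval \<rho> env y)"
  "ival \<rho> env (mulE a k) = ival \<rho> env a * k"
proof -
  show toR: "rval \<rho> env (toR a) = real (ival \<rho> env a)" for a by (simp add: toR_def)
  show notE: "ival \<rho> env (notE a) = of_bool (ival \<rho> env a = 0)" for a
    by (simp add: notE_def toR)
  show andE: "ival \<rho> env (andE a b) = of_bool (ival \<rho> env a \<noteq> 0 \<and> ival \<rho> env b \<noteq> 0)" for a b
    by (simp add: andE_def notE)
  show "ival \<rho> env (orE a b) = of_bool (ival \<rho> env a \<noteq> 0 \<or> ival \<rho> env b \<noteq> 0)"
    by (simp add: orE_def notE)
  show "ival \<rho> env (eqE a b) = of_bool (ival \<rho> env a = ival \<rho> env b)"
    by (auto simp: eqE_def andE toR)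
  show ifE: "rval \<rho> env (ifE a x y) = (if ival \<rho> env a \<noteq> 0 then rval \<rho> env x else rval \<rho> env y)"
    for a x y by (simp add: ifE_def notE toR)
  show "rval \<rho> env (absE x) = \<bar>rval \<rho> env x\<bar>" by (simp add: absE_def ifE)
  show "rval \<rho> env (maxE x y) = max (rval \<rho> env x) (rval \<rho> env y)" by (simp add: maxE_def ifE)
  show "ival \<rho> env (mulE a k) = ival \<rho> env a * k" by (simp add: mulE_def)
qed

primrec distE :: "nat \<Rightarrow> (nat \<Rightarrow> rexp) \<Rightarrow> (nat \<Rightarrow> rexp) \<Rightarrow> rexp" where
  "distE 0 x y = RCst 0"
| "distE (Suc d) x y = maxE (distE d x y) (absE (RMinus (x d) (y d)))"

lemma rval_distE [simp]:
  "d > 0 \<Longrightarrow> rval \<rho> env (distE d x y) =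
    linf_dist d (\<lambda>k. rval \<rho> env (x k)) (\<lambda>k. rval \<rho> env (y k))"
proof (induction d)
  case (Suc d)
  \<comment> \<open>For one coordinate the initial 0 of \<open>distE\<close> is absorbed, absolute
    values being nonnegative; \<open>linf_dist 0\<close> itself is a maximum over the empty
    set.\<close>
  then show ?case by (cases "d = 0") (simp_all add: linf_dist_Suc, simp add: linf_dist_def)
qed simp

text \<open>Variables 0 and 1 hold \<open>n\<close> and \<open>m\<close>, variable 2 is a dummy, 3, 4 and 5 run over
  candidates, voters and rivals. Coordinate \<open>k\<close> of the new position is \<open>c 0 k - eps\<close> if variable
  \<open>6 + 3 * k\<close> is 0; otherwise variables \<open>7 + 3 * k\<close> and \<open>8 + 3 * k\<close> give the voter and the
  candidate of a threshold, which is the lower one if variable \<open>6 + 3 * k\<close> is 1 and the upper one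
  if it is 3. All of these range up to \<open>n + m + 3\<close>: meaningless choices are harmless because
  the resulting position is tested for being within \<open>eps\<close> of the old one.\<close>

definition candE :: "nat \<Rightarrow> iexp \<Rightarrow> nat \<Rightarrow> rexp" where
  "candE d j k = RIn (IPlus (IPlus (IVar 0) (ICst (k + 1))) (mulE j d))"

text \<open>Voters are stored right after the candidates with the same stride, so voter
  \<open>i\<close> is row \<open>n + i\<close>.\<close>

definition voterE :: "nat \<Rightarrow> iexp \<Rightarrow> nat \<Rightarrow> rexp" where
  "voterE d i k = RIn (IPlus (IPlus (IVar 0) (ICst (k + 1))) (mulE (IPlus (IVar 0) i) d))"

definition pointE :: "nat \<Rightarrow> nat \<Rightarrow> rexp" where
  "pointE d k = ifE (IVar (6 + 3 * k))
     (RPlus (voterE d (IVar (7 + 3 * k)) k)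
       (RTimes (RMinus (toR (IVar (6 + 3 * k))) (RCst 2))
         (distE d (voterE d (IVar (7 + 3 * k))) (candE d (IVar (8 + 3 * k))))))
     (RMinus (candE d (ICst 0) k) (RIn (ICst 0)))"

definition newdistE :: "nat \<Rightarrow> iexp \<Rightarrow> iexp \<Rightarrow> rexp" where
  "newdistE d i j = distE d (voterE d i) (\<lambda>k. ifE j (candE d j k) (pointE d k))"

definition prefersE :: "nat \<Rightarrow> iexp \<Rightarrow> iexp \<Rightarrow> iexp \<Rightarrow> iexp" where
  "prefersE d i j' j = orE (notE (ILe (newdistE d i j) (newdistE d i j')))
     (andE (ILe (newdistE d i j') (newdistE d i j)) (andE (notE j) j'))"

definition rankE :: "nat \<Rightarrow> iexp \<Rightarrow> iexp \<Rightarrow> iexp" where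
  "rankE d i j = IPlus (ICst 1)
     (ISum 3 (IVar 0) (andE (notE (eqE (IVar 3) j)) (prefersE d i (IVar 3) j)))"

text \<open>The input keeps \<open>f t\<close> in cell \<open>t\<close>, so a rank can be used
  directly as an address.\<close>

definition scoreE :: "nat \<Rightarrow> iexp \<Rightarrow> rexp" where
  "scoreE d j = RSum 4 (IVar 1) (RIn (rankE d (IVar 4) j))"

definition loseE :: "nat \<Rightarrow> iexp" where
  "loseE d = ISum 5 (IVar 0) (andE (IVar 5) (ILe (scoreE d (ICst 0)) (scoreE d (IVar 5))))"

definition boxE :: "nat \<Rightarrow> iexp" where
  "boxE d = ILe (distE d (pointE d) (candE d (ICst 0))) (RIn (ICst 0))"

text \<open>Existential quantification over variables \<open>6..<6 + l\<close>. The summand 4 in the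
  range keeps the selector value 3 available however small \<open>n\<close> and \<open>m\<close>
  are.\<close>

primrec searchE :: "nat \<Rightarrow> iexp \<Rightarrow> iexp" where
  "searchE 0 e = e"
| "searchE (Suc l) e = ISum (6 + l) (IPlus (IPlus (IVar 0) (IVar 1)) (ICst 4)) (searchE l e)"

text \<open>The double negation turns the count of successful choices into the 0/1 answer that
  \<open>accepts\<close> tests.\<close>

definition controlE :: "nat \<Rightarrow> iexp" where
  "controlE d = notE (notE (searchE (3 * d) (andE (boxE d) (loseE d))))"

lemma ival_searchE:
  "ival \<rho> env (searchE l e) \<noteq> 0 \<longleftrightarrow>
    (\<exists>env'. (\<forall>y. y < 6 \<or> 6 + l \<le> y \<longrightarrow> env' y = env y) \<and>
       (\<forall>y. 6 \<le> y \<and> y < 6 + l \<longrightarrow> env' y < env 0 + env 1 + 4) \<and> ival \<rho> env' e \<noteq> 0)"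
proof (induction l arbitrary: env)
  case 0
  have "env' = env" if "\<forall>y. y < 6 \<or> 6 \<le> y \<longrightarrow> env' y = env y" for env' :: "nat \<Rightarrow> nat"
    using that by (metis ext not_less)
  then show ?case by auto
next
  case (Suc l)
  let ?N = "env 0 + env 1 + 4"
  have "ival \<rho> env (searchE (Suc l) e) \<noteq> 0 \<longleftrightarrow>
      (\<exists>z<?N. ival \<rho> (env(6 + l := z)) (searchE l e) \<noteq> 0)"
    by (auto simp: lessThan_iff)
  also have "\<dots> \<longleftrightarrow> (\<exists>z<?N. \<exists>env'.
      (\<forall>y. y < 6 \<or> 6 + l \<le> y \<longrightarrow> env' y = (env(6 + l := z)) y) \<and>
      (\<forall>y. 6 \<le> y \<and> y < 6 + l \<longrightarrow> env' y < ?N) \<and> ival \<rho> env' e \<noteq> 0)"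
    unfolding Suc.IH by simp
  also have "\<dots> \<longleftrightarrow> (\<exists>env'. (\<forall>y. y < 6 \<or> 6 + Suc l \<le> y \<longrightarrow> env' y = env y) \<and>
       (\<forall>y. 6 \<le> y \<and> y < 6 + Suc l \<longrightarrow> env' y < ?N) \<and> ival \<rho> env' e \<noteq> 0)" (is "?L \<longleftrightarrow> ?R")
  proof
    assume ?L
    then obtain z env' where z: "z < ?N"
      "\<And>y. y < 6 \<or> 6 + l \<le> y \<Longrightarrow> env' y = (env(6 + l := z)) y"
      "\<And>y. 6 \<le> y \<and> y < 6 + l \<Longrightarrow> env' y < ?N" "ival \<rho> env' e \<noteq> 0" by blast
    have "env' y < ?N" if "6 \<le> y" "y < 6 + Suc l" for y
      using z(1) z(2)[of y] z(3)[of y] that by (cases "y = 6 + l") auto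
    then show ?R using z(2,4) by (intro exI[of _ env']) auto
  next
    assume ?R
    then obtain env' where e: "\<And>y. y < 6 \<or> 6 + Suc l \<le> y \<Longrightarrow> env' y = env y"
      "\<And>y. 6 \<le> y \<and> y < 6 + Suc l \<Longrightarrow> env' y < ?N" "ival \<rho> env' e \<noteq> 0" by blast
    have "env' y = (env(6 + l := env' (6 + l))) y" if "y < 6 \<or> 6 + l \<le> y" for y
      using e(1)[of y] that by (cases "y = 6 + l") auto
    moreover have "env' (6 + l) < ?N" "\<forall>y. 6 \<le> y \<and> y < 6 + l \<longrightarrow> env' y < ?N"
      using e(2) by auto
    ultimately show ?L using e(3) by blast
  qed
  finally show ?case .
qed

lemma rval_candE [simp]:
  "rval \<rho> env (candE d j k) = \<rho> (env 0 + (k + 1) + ival \<rho> env j * d)"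
  by (simp add: candE_def)

lemma rval_voterE [simp]:
  "rval \<rho> env (voterE d i k) = \<rho> (env 0 + (k + 1) + (env 0 + ival \<rho> env i) * d)"
  by (simp add: voterE_def)

text \<open>The loops over candidates, voters and rivals do not touch the selectors, so one guessed
  position is used throughout.\<close>

lemma rval_pointE_upd [simp]:
  "d > 0 \<Longrightarrow> y \<in> {3, 4, 5} \<Longrightarrow> rval \<rho> (env(y := z)) (pointE d k) = rval \<rho> env (pointE d k)"
  by (auto simp: pointE_def)

section \<open>The search expression evaluated on an encoded instance\<close>

context
  fixes d n m :: nat and f :: "nat \<Rightarrow> real" and c v :: "nat \<Rightarrow> nat \<Rightarrow> real" and eps :: real
    and \<rho> :: "nat \<Rightarrow> real"
  assumes d: "d > 0" and \<rho>: "\<rho> = snd (snd (input_config d n m f c v eps))"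
begin

lemma input_eps: "\<rho> 0 = eps"
  by (simp add: \<rho> input_config_def)

lemma input_score: "1 \<le> t \<Longrightarrow> t \<le> n \<Longrightarrow> \<rho> t = f t"
  by (simp add: \<rho> input_config_def)

lemma input_cand:
  assumes "j < n" "k < d"
  shows "\<rho> (n + (k + 1) + j * d) = c j k"
proof -
  have "j * d + k < Suc j * d" using assms by simp
  also have "\<dots> \<le> n * d" using assms by (intro mult_le_mono1) simp
  finally have "j * d + k < n * d" .
  then show ?thesis using assms by (simp add: \<rho> input_config_def add.commute)
qed

lemma input_voter:
  assumes "i < m" "k < d"
  shows "\<rho> (n + (k + 1) + (n + i) * d) = v i k"
proof -
  have "i * d + k < Suc i * d" using assms by simp
  also have "\<dots> \<le> m * d" using assms by (intro mult_le_mono1) simp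
  finally have "i * d + k < m * d" .
  then show ?thesis using assms by (simp add: \<rho> input_config_def algebra_simps)
qed

lemma input_zero: "a > n + d * (n + m) \<Longrightarrow> \<rho> a = 0"
  by (simp add: \<rho> input_config_def algebra_simps)

definition newpos :: "(nat \<Rightarrow> nat) \<Rightarrow> nat \<Rightarrow> real" where
  "newpos env k = rval \<rho> env (pointE d k)"

lemma rval_newdistE:
  assumes "env 0 = n" "ival \<rho> env i < m" "ival \<rho> env j < n"
  shows "rval \<rho> env (newdistE d i j) =
    linf_dist d (v (ival \<rho> env i)) ((c(0 := newpos env)) (ival \<rho> env j))"
  using d assms input_cand input_voter
  by (auto simp: newdistE_def newpos_def intro!: linf_dist_cong)

lemma ival_prefersE:
  assumes "env 0 = n" "ival \<rho> env i < m" "ival \<rho> env j' < n" "ival \<rho> env j < n"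
  shows "ival \<rho> env (prefersE d i j' j) =
    of_bool (prefers d (c(0 := newpos env)) v (ival \<rho> env i) (ival \<rho> env j') (ival \<rho> env j))"
  using assms by (auto simp: prefersE_def prefers_def rval_newdistE simp del: fun_upd_apply)

lemma newpos_upd: "y \<in> {3, 4, 5} \<Longrightarrow> newpos (env(y := z)) = newpos env"
  using d by (auto simp: newpos_def)

text \<open>The last hypothesis excludes variable capture: \<open>j\<close> must not depend on the
  variable 3 bound in \<open>rankE\<close>.\<close>

lemma ival_rankE:
  assumes "env 0 = n" "env 4 < m" "ival \<rho> env j < n"
    and j: "\<And>z. ival \<rho> (env(3 := z)) j = ival \<rho> env j"
  shows "ival \<rho> env (rankE d (IVar 4) j) =
    rank d n (c(0 := newpos env)) v (env 4) (ival \<rho> env j)"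
proof -
  have "(\<Sum>z<n. ival \<rho> (env(3 := z))
        (andE (notE (eqE (IVar 3) j)) (prefersE d (IVar 4) (IVar 3) j))) =
      (\<Sum>z<n. of_bool (z \<noteq> ival \<rho> env j
        \<and> prefers d (c(0 := newpos env)) v (env 4) z (ival \<rho> env j)))"
    using assms by (intro sum.cong) (simp_all add: ival_prefersE newpos_upd)
  also have "\<dots> = card {z \<in> {0..<n}. z \<noteq> ival \<rho> env j
        \<and> prefers d (c(0 := newpos env)) v (env 4) z (ival \<rho> env j)}"
    by (simp add: Int_def atLeast0LessThan)
  finally show ?thesis using assms(1) by (simp add: rankE_def rank_def)
qed

lemma rval_scoreE:
  assumes "env 0 = n" "env 1 = m" "ival \<rho> env j < n"
    and j: "\<And>y z env. y \<in> {3, 4} \<Longrightarrow> ival \<rho> (env(y := z)) j = ival \<rho> env j"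
  shows "rval \<rho> env (scoreE d j) = score d n m f (c(0 := newpos env)) v (ival \<rho> env j)"
  unfolding scoreE_def score_def rval.simps ival.simps assms(2)
  using assms rank_bounds
  by (intro sum.cong) (auto simp: ival_rankE newpos_upd input_score simp del: ival.simps(3))

lemma ival_loseE:
  assumes "env 0 = n" "env 1 = m"
  shows "ival \<rho> env (loseE d) \<noteq> 0 \<longleftrightarrow> (\<exists>j\<in>{1..<n}.
    score d n m f (c(0 := newpos env)) v j \<ge> score d n m f (c(0 := newpos env)) v 0)"
proof -
  have 1: "rval \<rho> (env(5 := j)) (scoreE d (IVar 5)) = score d n m f (c(0 := newpos env)) v j"
    "rval \<rho> (env(5 := j)) (scoreE d (ICst 0)) = score d n m f (c(0 := newpos env)) v 0"
    if "j < n" for j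
    by (subst rval_scoreE; use that assms in \<open>auto simp: newpos_upd\<close>)+
  have "ival \<rho> env (loseE d) \<noteq> 0 \<longleftrightarrow> (\<exists>j<n. j \<noteq> 0 \<and>
      rval \<rho> (env(5 := j)) (scoreE d (ICst 0)) \<le> rval \<rho> (env(5 := j)) (scoreE d (IVar 5)))"
    unfolding loseE_def ival.simps assms(1) by (auto simp del: fun_upd_apply) auto
  then show ?thesis using 1 by (auto simp: Bex_def Suc_le_eq)
qed

lemma ival_boxE:
  assumes "env 0 = n" "n > 0"
  shows "ival \<rho> env (boxE d) \<noteq> 0 \<longleftrightarrow> linf_dist d (newpos env) (c 0) \<le> eps"
proof -
  have "linf_dist d (newpos env) (\<lambda>k. \<rho> (n + (k + 1))) = linf_dist d (newpos env) (c 0)"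
    using input_cand[of 0] assms by (intro linf_dist_cong) auto
  with assms d show ?thesis by (simp add: boxE_def input_eps newpos_def[abs_def])
qed

text \<open>Stated with raw addresses because selectors may be out of range and then point at
  unrelated cells.\<close>

lemma newpos_eq:
  assumes "env 0 = n" "k < d" "n > 0"
  shows "newpos env k = (if env (6 + 3 * k) = 0 then c 0 k - eps
    else \<rho> (n + (k + 1) + (n + env (7 + 3 * k)) * d) + (real (env (6 + 3 * k)) - 2) *
      linf_dist d (\<lambda>k'. \<rho> (n + (k' + 1) + (n + env (7 + 3 * k)) * d))
        (\<lambda>k'. \<rho> (n + (k' + 1) + env (8 + 3 * k) * d)))"
  using input_cand[of 0 k] assms d by (simp add: newpos_def pointE_def input_eps)

lemma ival_controlE:
  assumes "env 0 = n" "env 1 = m" "valid_instance d n m f c v eps"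
  shows "ival \<rho> env (controlE d) = of_bool (destructive_control d n m f c v eps)"
proof -
  have n: "n > 0" and f: "\<And>s t. 1 \<le> s \<Longrightarrow> s \<le> t \<Longrightarrow> t \<le> n \<Longrightarrow> f t \<le> f s"
    using assms(3) by (auto simp: valid_instance_def)
  let ?r = "\<lambda>i j. linf_dist d (v i) (c j)"
  let ?N = "env 0 + env 1 + 4"
  have "ival \<rho> env (searchE (3 * d) (andE (boxE d) (loseE d))) \<noteq> 0
    \<longleftrightarrow> destructive_control d n m f c v eps"
    unfolding ival_searchE
  proof
    assume "\<exists>env'. (\<forall>y. y < 6 \<or> 6 + 3 * d \<le> y \<longrightarrow> env' y = env y) \<and>
      (\<forall>y. 6 \<le> y \<and> y < 6 + 3 * d \<longrightarrow> env' y < ?N) \<and> ival \<rho> env' (andE (boxE d) (loseE d)) \<noteq> 0"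
    then obtain env' where e: "\<And>y. y < 6 \<Longrightarrow> env' y = env y"
      "ival \<rho> env' (boxE d) \<noteq> 0" "ival \<rho> env' (loseE d) \<noteq> 0" by auto
    have "env' 0 = n" "env' 1 = m" using e(1) assms by simp_all
    then show "destructive_control d n m f c v eps"
      using ival_boxE[of env'] ival_loseE[of env'] e(2,3) n unfolding destructive_control_def
      by blast
  next
    assume "destructive_control d n m f c v eps"
    then obtain x j where x: "linf_dist d x (c 0) \<le> eps" "j \<in> {1..<n}"
      "score d n m f (c(0 := x)) v j \<ge> score d n m f (c(0 := x)) v 0"
      by (auto simp: destructive_control_def)
    obtain y where y: "\<And>k. k < d \<Longrightarrow> y k = c 0 k - eps \<or>
          (\<exists>i<m. \<exists>j<n. y k = v i k - ?r i j \<or> y k = v i k + ?r i j)"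
        "linf_dist d y (c 0) \<le> eps"
        "\<And>i j. i < m \<Longrightarrow> j < n \<Longrightarrow> ?r i j \<le> linf_dist d (v i) x \<Longrightarrow> ?r i j \<le> linf_dist d (v i) y"
      using round_down[OF d x(1), of m n v ?r] by blast
    \<comment> \<open>The selector is 0 for the end of the range, 1 for a lower and 3 for an upper
      threshold, so that \<open>s - 2\<close> is the sign of the distance.\<close>
    have "\<exists>s i j. s < ?N \<and> i < ?N \<and> j < ?N \<and> (if s = 0 then y k = c 0 k - eps
        else i < m \<and> j < n \<and> y k = v i k + (real s - 2) * ?r i j)" if k: "k < d" for k
      using y(1)[OF k]
    proof (elim disjE exE conjE)
      assume "y k = c 0 k - eps"
      then show ?thesis by (intro exI[of _ 0]) auto
    next
      fix i j assume "i < m" "j < n" "y k = v i k - ?r i j"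
      then show ?thesis using assms
        by - (rule exI[of _ 1], rule exI[of _ i], rule exI[of _ j], auto)
    next
      fix i j assume "i < m" "j < n" "y k = v i k + ?r i j"
      then show ?thesis using assms
        by - (rule exI[of _ 3], rule exI[of _ i], rule exI[of _ j], auto)
    qed
    then obtain s i h where sel: "\<And>k. k < d \<Longrightarrow> s k < ?N \<and> i k < ?N \<and> h k < ?N \<and>
      (if s k = 0 then y k = c 0 k - eps
        else i k < m \<and> h k < n \<and> y k = v (i k) k + (real (s k) - 2) * ?r (i k) (h k))"
      by metis
    \<comment> \<open>Variable \<open>6 + 3 * k + r\<close> with \<open>r < 3\<close> is decoded by
      \<open>z div 3 - 2 = k\<close> and \<open>z mod 3 = r\<close>.\<close>
    define env' where "env' z = (if z < 6 \<or> 6 + 3 * d \<le> z then env z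
      else if z mod 3 = 0 then s (z div 3 - 2) else if z mod 3 = 1 then i (z div 3 - 2)
      else h (z div 3 - 2))" for z
    have e: "env' (6 + 3 * k) = s k" "env' (7 + 3 * k) = i k" "env' (8 + 3 * k) = h k"
      if "k < d" for k
    proof -
      have "(6 + 3 * k) mod 3 = 0" "(6 + 3 * k) div 3 = k + 2" "(7 + 3 * k) mod 3 = 1"
        "(7 + 3 * k) div 3 = k + 2" "(8 + 3 * k) mod 3 = 2" "(8 + 3 * k) div 3 = k + 2"
        by presburger+
      with that show "env' (6 + 3 * k) = s k" "env' (7 + 3 * k) = i k" "env' (8 + 3 * k) = h k"
        by (simp_all add: env'_def)
    qed
    have e01: "env' 0 = n" "env' 1 = m" using assms by (simp_all add: env'_def)
    have range: "env' z < ?N" if "6 \<le> z" "z < 6 + 3 * d" for z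
    proof -
      have "z div 3 - 2 < d" using that by presburger
      from sel[OF this] that show ?thesis by (simp add: env'_def)
    qed
    have newpos: "newpos env' k = y k" if "k < d" for k
    proof (cases "s k = 0")
      case True
      with sel[OF that] e[OF that] n that e01 show ?thesis by (simp add: newpos_eq)
    next
      case False
      with sel[OF that] have ih: "i k < m" "h k < n"
        "y k = v (i k) k + (real (s k) - 2) * ?r (i k) (h k)" by auto
      have "linf_dist d (\<lambda>k'. \<rho> (n + (k' + 1) + (n + i k) * d))
          (\<lambda>k'. \<rho> (n + (k' + 1) + h k * d)) = ?r (i k) (h k)"
        by (rule linf_dist_cong) (use ih input_cand input_voter in auto)
      then show ?thesis
        using newpos_eq[of env', OF e01(1) that n] False ih input_voter[OF ih(1) that]
        unfolding e[OF that] by simp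
    qed
    have "linf_dist d (newpos env') (c 0) \<le> eps"
      using y(2) linf_dist_cong[of d "newpos env'" y "c 0" "c 0"] newpos by simp
    moreover have "?r i j \<le> linf_dist d (v i) (newpos env')"
      if "i < m" "j < n" "?r i j \<le> linf_dist d (v i) x" for i j
      using y(3)[OF that] linf_dist_cong[of d "v i" "v i" "newpos env'" y] newpos by simp
    \<comment> \<open>Chained through the scores at \<open>x\<close>: the target does not gain by
      rounding, it was already no better than \<open>j\<close> there, and \<open>j\<close> does not
      drop.\<close>
    then have "score d n m f (c(0 := newpos env')) v 0 \<le> score d n m f (c(0 := newpos env')) v j"
      using score_farther[where x = x and y = "newpos env'" and f = f and n = n and m = m and v = v
          and c = c and d = d] f n x(2,3) by fastforce
    ultimately have "ival \<rho> env' (andE (boxE d) (loseE d)) \<noteq> 0"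
      using ival_boxE[of env', OF e01(1) n] ival_loseE[of env', OF e01] x(2) by auto
    with range show "\<exists>env'. (\<forall>y. y < 6 \<or> 6 + 3 * d \<le> y \<longrightarrow> env' y = env y) \<and>
      (\<forall>y. 6 \<le> y \<and> y < 6 + 3 * d \<longrightarrow> env' y < ?N) \<and> ival \<rho> env' (andE (boxE d) (loseE d)) \<noteq> 0"
      by (intro exI[of _ env']) (auto simp: env'_def)
  qed
  then show ?thesis by (simp add: controlE_def)
qed

end

theorem theorem9:
  "\<forall>d::nat. \<exists>(P::instr list) (K::nat).
     \<forall>n m f c v eps.
       valid_instance d n m f c v eps \<longrightarrow>
       (\<exists>t. t \<le> K * (n + m + 1) ^ K \<and>
            halted P (run P t (input_config d n m f c v eps)) \<and>
            (accepts (run P t (input_config d n m f c v eps))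
               \<longleftrightarrow> destructive_control d n m f c v eps))"
proof
  fix d :: nat
  show "\<exists>(P::instr list) (K::nat).
     \<forall>n m f c v eps.
       valid_instance d n m f c v eps \<longrightarrow>
       (\<exists>t. t \<le> K * (n + m + 1) ^ K \<and>
            halted P (run P t (input_config d n m f c v eps)) \<and>
            (accepts (run P t (input_config d n m f c v eps))
               \<longleftrightarrow> destructive_control d n m f c v eps))"
  proof (cases "d > 0")
    case True
    obtain P K where PK: "\<And>n m \<rho> im. (\<forall>a > n + d * (n + m). \<rho> a = 0) \<Longrightarrow> im 1 = int n
      \<Longrightarrow> im 2 = int m \<Longrightarrow> (\<forall>y>2. im y = 0)
      \<Longrightarrow> \<exists>t env. t \<le> K * (n + m + 1) ^ K \<and> halted P (run P t (0, im, \<rho>)) \<and> env 0 = n \<and>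
        env 1 = m \<and> fst (snd (run P t (0, im, \<rho>))) 0 = int (ival \<rho> env (controlE d))"
      using ival_decidable[OF True, of "controlE d"] by blast
    show ?thesis
    proof (rule exI[of _ P], rule exI[of _ K], intro allI impI)
      fix n m f c v eps
      assume valid: "valid_instance d n m f c v eps"
      define im where "im = fst (snd (input_config d n m f c v eps))"
      define \<rho> where "\<rho> = snd (snd (input_config d n m f c v eps))"
      have cfg: "input_config d n m f c v eps = (0, im, \<rho>)"
        by (simp add: im_def \<rho>_def input_config_def)
      have "\<forall>a > n + d * (n + m). \<rho> a = 0" using input_zero[OF True \<rho>_def] by blast
      moreover have "im 1 = int n" "im 2 = int m" "\<forall>y>2. im y = 0"
        by (simp_all add: im_def input_config_def)
      ultimately obtain t env where t: "t \<le> K * (n + m + 1) ^ K" "halted P (run P t (0, im, \<rho>))"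
        "env 0 = n" "env 1 = m"
        "fst (snd (run P t (0, im, \<rho>))) 0 = int (ival \<rho> env (controlE d))"
        using PK[of n m \<rho> im] by blast
      have "accepts (run P t (0, im, \<rho>)) \<longleftrightarrow> destructive_control d n m f c v eps"
        using t(5) ival_controlE[where env = env, OF True \<rho>_def t(3,4) valid]
        by (simp add: accepts_def)
      with t(1,2) show "\<exists>t. t \<le> K * (n + m + 1) ^ K \<and>
            halted P (run P t (input_config d n m f c v eps)) \<and>
            (accepts (run P t (input_config d n m f c v eps))
               \<longleftrightarrow> destructive_control d n m f c v eps)"
        unfolding cfg by blast
    qed
  next
    \<comment> \<open>For \<open>d = 0\<close> there is no valid instance, so the claim is
      vacuous.\<close>
    case False
    then show ?thesis by (auto simp: valid_instance_def)
  qed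
qed

end
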